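(* Let $S$ be a set of sorts and $\Sigma$ an $S$-sorted signature. The complete lattices $\mathbf{Form}_{\mathrm{Alg}}(\Sigma)$ (all formations of $\Sigma$-algebras, ordered by inclusion) and $\mathbf{Form}_{\mathrm{Cgr}}(\Sigma)$ (all formations of congruences with respect to $\Sigma$, ordered pointwise by inclusion) are isomorphic.
   Context: Fix a Grothendieck universe $\mathcal{U}$, a set of sorts $S\in\mathcal{U}$ and an $S$-sorted signature $\Sigma$, i.e. a family of sets $\Sigma_{w,s}\in\mathcal{U}$ indexed by $w\in S^{\star}$ (finite words on $S$) and $s\in S$. An $S$-sorted set is a family $A=(A_s)_{s\in S}$ of sets in $\mathcal{U}$ (components may be empty); $\mathcal{U}^S$ is the set of all of them. $S$-sorted mappings, subsets, products, intersections, etc. are defined componentwise. A $\Sigma$-algebra $\mathbf{A}$ is an $S$-sorted set $A$ with an operation $F_\sigma\colon A_w=\prod_{i<|w|}A_{w_i}\to A_s$ for each $\sigma\in\Sigma_{w,s}$; homomorphisms are $S$-sorted mappings commuting with all operations. Epimorphism means homomorphism surjective in each sort; monomorphism means injective in each sort. $\mathrm{Alg}(\Sigma)$ is the set of all $\Sigma$-algebras; a "set of $\Sigma$-algebras" is any subset of it (not necessarily $\mathcal{U}$-small). A congruence on $\mathbf{A}$ is a family $\Phi=(\Phi_s)_{s\in S}$ of equivalence relations $\Phi_s$ on $A_s$ compatible with all operations; $\mathbf{Cgr}(\mathbf{A})$ is the lattice of all congruences under componentwise inclusion, $\mathbf{A}/\Phi$ the quotient algebra and $\mathrm{pr}^{\Phi}\colon\mathbf{A}\to\mathbf{A}/\Phi$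 the projection. $\mathbf{T}_\Sigma(A)$ is the free $\Sigma$-algebra on the $S$-sorted set $A$. $\mathrm{Ker}(f)$ is the (componentwise) kernel congruence of $f$. A subdirect embedding $f\colon\mathbf{A}\to\prod_{i\in I}\mathbf{C}^i$ is an injective homomorphism such that each $\mathrm{pr}^i\circ f\colon\mathbf{A}\to\mathbf{C}^i$ is surjective (the empty product is the final algebra $\mathbf{1}$, with one element in each sort). A formation of $\Sigma$-algebras is a set $\mathcal{F}\subseteq\mathrm{Alg}(\Sigma)$ such that: (1) $\mathcal{F}\neq\varnothing$; (2) $\mathcal{F}$ is closed under isomorphism; (3) if $\mathbf{B}\in\mathcal{F}$ and there is an epimorphism $\mathbf{B}\to\mathbf{A}$, then $\mathbf{A}\in\mathcal{F}$; (4) if for some $n\in\mathbb{N}$ (including $n=0$) and some family $(\mathbf{C}^{\alpha})_{\alpha<n}$ in $\mathcal{F}$ there is a subdirect embedding $\mathbf{A}\to\prod_{\alpha<n}\mathbf{C}^{\alpha}$, then $\mathbf{A}\in\mathcal{F}$. A formation of congruences with respect to $\Sigma$ is a function $\mathfrak{F}$ on $\mathcal{U}^S$ such that: (1) for every $A\in\mathcal{U}^S$, $\mathfrak{F}(A)$ is a filter of $\mathbf{Cgr}(\mathbf{T}_\Sigma(A))$ (nonempty, closed under binary intersection, upward closed); (2) for all $A,B\in\mathcal{U}^S$, $\Theta\in\mathfrak{F}(B)$ and homomorphisms $f\colon\mathbf{T}_\Sigma(A)\to\mathbf{T}_\Sigma(B)$, if $\mathrm{pr}^{\Theta}\circ f$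 is an epimorphism, then $\mathrm{Ker}(\mathrm{pr}^{\Theta}\circ f)\in\mathfrak{F}(A)$. The order is $\mathfrak{F}\le\mathfrak{G}$ iff $\mathfrak{F}(A)\subseteq\mathfrak{G}(A)$ for all $A\in\mathcal{U}^S$. *)

theory Defs
  imports "HOL-Algebra.Complete_Lattice" "HOL-Library.FuncSet"
begin

section \<open>Grothendieck universes\<close>

text \<open>
  A Grothendieck universe, presented by its membership relation: the type \<open>'v\<close> is the set of its
  elements, and \<open>elts x\<close> is the set of all members of \<open>x\<close>. As the members of \<open>x\<close> are again of type
  \<open>'v\<close>, transitivity of the universe is built in. The collection of sets that belong to the
  universe is \<open>range elts\<close>. Ordered pairs and binary products are obtained from pairing and power
  sets. In \<open>powerset\<close>, the members of \<open>y\<close> are \<^emph>\<open>all\<close> subsets of \<open>elts x\<close>; likewise \<open>replacement\<close>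
  quantifies over all functions of HOL.
\<close>

locale grothendieck_universe =
  fixes elts :: "'v \<Rightarrow> 'v set"
  assumes extensionality: "inj elts"
    and foundation: "wf {(x, y). x \<in> elts y}"
    and pairing: "\<exists>z. elts z = {x, y}"
    and union: "\<exists>y. elts y = (\<Union>z\<in>elts x. elts z)"
    and powerset: "\<exists>y. elts ` elts y = Pow (elts x)"
    and replacement: "\<exists>y. elts y = f ` elts x"
    and omega: "\<exists>(num :: nat \<Rightarrow> 'v) w. elts (num 0) = {} \<and>
      (\<forall>n. elts (num (Suc n)) = insert (num n) (elts (num n))) \<and> elts w = range num"


section \<open>Many-sorted algebras\<close>

text \<open>
  A set of sorts is \<open>S :: 's set\<close>, and a signature is \<open>\<Sigma> :: 's list \<Rightarrow> 's \<Rightarrow> 'f set\<close>, of which only the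
  values \<open>\<Sigma> w s\<close> with \<open>w \<in> lists S\<close> and \<open>s \<in> S\<close> matter. The sets \<open>\<Sigma> w s\<close> need not be disjoint, so
  operations are indexed by \<open>w\<close>, \<open>s\<close> and the symbol. All families indexed by \<open>S\<close> and all operations
  are extensional, so that equality in HOL is equality of the families and operations.
\<close>

type_synonym ('s, 'f) signature = "'s list \<Rightarrow> 's \<Rightarrow> 'f set"

record ('s, 'f, 'a) alg =
  car :: "'s \<Rightarrow> 'a set"
  opn :: "'s list \<Rightarrow> 's \<Rightarrow> 'f \<Rightarrow> 'a list \<Rightarrow> 'a"

definition is_symbol :: "'s set \<Rightarrow> ('s, 'f) signature \<Rightarrow> 's list \<Rightarrow> 's \<Rightarrow> 'f \<Rightarrow> bool" where
  "is_symbol S \<Sigma> w s \<sigma> \<longleftrightarrow> w \<in> lists S \<and> s \<in> S \<and> \<sigma> \<in> \<Sigma> w s"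

definition tuples :: "('s \<Rightarrow> 'a set) \<Rightarrow> 's list \<Rightarrow> 'a list set" where
  "tuples A w = {xs. list_all2 (\<lambda>x s. x \<in> A s) xs w}"

definition algebra :: "'s set \<Rightarrow> ('s, 'f) signature \<Rightarrow> ('s, 'f, 'a) alg \<Rightarrow> bool" where
  "algebra S \<Sigma> A \<longleftrightarrow> car A \<in> extensional S \<and>
     (\<forall>w s \<sigma>. if is_symbol S \<Sigma> w s \<sigma> then opn A w s \<sigma> \<in> tuples (car A) w \<rightarrow>\<^sub>E car A s
              else opn A w s \<sigma> = undefined)"

definition mk_alg :: "'s set \<Rightarrow> ('s, 'f) signature \<Rightarrow> ('s \<Rightarrow> 'a set) \<Rightarrow>
    ('s list \<Rightarrow> 's \<Rightarrow> 'f \<Rightarrow> 'a list \<Rightarrow> 'a) \<Rightarrow> ('s, 'f, 'a) alg" where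
  "mk_alg S \<Sigma> A F = \<lparr>car = restrict A S,
     opn = (\<lambda>w s \<sigma>. if is_symbol S \<Sigma> w s \<sigma> then restrict (F w s \<sigma>) (tuples A w) else undefined)\<rparr>"

text \<open>
  \<open>sorted_sets U S\<close> is \<open>U\<^sup>S\<close>, and \<open>Alg U S \<Sigma>\<close> is the set of all algebras whose components are
  members of \<open>U\<close>. Elsewhere algebras live on arbitrary types, in order to accommodate term
  algebras, quotients and products.
\<close>

definition sorted_sets :: "'a set set \<Rightarrow> 's set \<Rightarrow> ('s \<Rightarrow> 'a set) set" where
  "sorted_sets U S = S \<rightarrow>\<^sub>E U"

definition Alg :: "'a set set \<Rightarrow> 's set \<Rightarrow> ('s, 'f) signature \<Rightarrow> ('s, 'f, 'a) alg set" where
  "Alg U S \<Sigma> = {A. algebra S \<Sigma> A \<and> car A \<in> sorted_sets U S}"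


subsection \<open>Sorted mappings and homomorphisms\<close>

definition sorted_maps :: "'s set \<Rightarrow> ('s \<Rightarrow> 'a set) \<Rightarrow> ('s \<Rightarrow> 'b set) \<Rightarrow> ('s \<Rightarrow> 'a \<Rightarrow> 'b) set" where
  "sorted_maps S A B = (\<Pi>\<^sub>E s\<in>S. A s \<rightarrow>\<^sub>E B s)"

definition sorted_comp ::
    "'s set \<Rightarrow> ('s \<Rightarrow> 'a set) \<Rightarrow> ('s \<Rightarrow> 'b \<Rightarrow> 'c) \<Rightarrow> ('s \<Rightarrow> 'a \<Rightarrow> 'b) \<Rightarrow> ('s \<Rightarrow> 'a \<Rightarrow> 'c)" where
  "sorted_comp S A g f = (\<lambda>s\<in>S. compose (A s) (g s) (f s))"

definition sorted_inj :: "'s set \<Rightarrow> ('s \<Rightarrow> 'a set) \<Rightarrow> ('s \<Rightarrow> 'a \<Rightarrow> 'b) \<Rightarrow> bool" where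
  "sorted_inj S A f \<longleftrightarrow> (\<forall>s\<in>S. inj_on (f s) (A s))"

definition sorted_surj ::
    "'s set \<Rightarrow> ('s \<Rightarrow> 'a set) \<Rightarrow> ('s \<Rightarrow> 'b set) \<Rightarrow> ('s \<Rightarrow> 'a \<Rightarrow> 'b) \<Rightarrow> bool" where
  "sorted_surj S A B f \<longleftrightarrow> (\<forall>s\<in>S. f s ` A s = B s)"

definition alg_hom :: "'s set \<Rightarrow> ('s, 'f) signature \<Rightarrow> ('s, 'f, 'a) alg \<Rightarrow> ('s, 'f, 'b) alg \<Rightarrow>
    ('s \<Rightarrow> 'a \<Rightarrow> 'b) set" where
  "alg_hom S \<Sigma> A B = {f \<in> sorted_maps S (car A) (car B).
     \<forall>w s \<sigma>. is_symbol S \<Sigma> w s \<sigma> \<longrightarrow> (\<forall>xs\<in>tuples (car A) w.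
       f s (opn A w s \<sigma> xs) = opn B w s \<sigma> (map2 f w xs))}"

definition epimorphism :: "'s set \<Rightarrow> ('s, 'f) signature \<Rightarrow> ('s, 'f, 'a) alg \<Rightarrow> ('s, 'f, 'b) alg \<Rightarrow>
    ('s \<Rightarrow> 'a \<Rightarrow> 'b) \<Rightarrow> bool" where
  "epimorphism S \<Sigma> A B f \<longleftrightarrow> f \<in> alg_hom S \<Sigma> A B \<and> sorted_surj S (car A) (car B) f"

definition monomorphism :: "'s set \<Rightarrow> ('s, 'f) signature \<Rightarrow> ('s, 'f, 'a) alg \<Rightarrow> ('s, 'f, 'b) alg \<Rightarrow>
    ('s \<Rightarrow> 'a \<Rightarrow> 'b) \<Rightarrow> bool" where
  "monomorphism S \<Sigma> A B f \<longleftrightarrow> f \<in> alg_hom S \<Sigma> A B \<and> sorted_inj S (car A) f"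

definition isomorphic :: "'s set \<Rightarrow> ('s, 'f) signature \<Rightarrow> ('s, 'f, 'a) alg \<Rightarrow> ('s, 'f, 'b) alg \<Rightarrow>
    bool" where
  "isomorphic S \<Sigma> A B \<longleftrightarrow> (\<exists>f. epimorphism S \<Sigma> A B f \<and> monomorphism S \<Sigma> A B f)"


subsection \<open>Products and subdirect embeddings\<close>

definition prod_alg :: "'s set \<Rightarrow> ('s, 'f) signature \<Rightarrow> 'i set \<Rightarrow> ('i \<Rightarrow> ('s, 'f, 'a) alg) \<Rightarrow>
    ('s, 'f, 'i \<Rightarrow> 'a) alg" where
  "prod_alg S \<Sigma> I C = mk_alg S \<Sigma> (\<lambda>s. \<Pi>\<^sub>E i\<in>I. car (C i) s)
     (\<lambda>w s \<sigma> xs. \<lambda>i\<in>I. opn (C i) w s \<sigma> (map (\<lambda>x. x i) xs))"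

definition prod_pr :: "'s set \<Rightarrow> ('s, 'f) signature \<Rightarrow> 'i set \<Rightarrow> ('i \<Rightarrow> ('s, 'f, 'a) alg) \<Rightarrow> 'i \<Rightarrow>
    ('s \<Rightarrow> ('i \<Rightarrow> 'a) \<Rightarrow> 'a)" where
  "prod_pr S \<Sigma> I C i = (\<lambda>s\<in>S. \<lambda>x\<in>car (prod_alg S \<Sigma> I C) s. x i)"

definition subdirect_embedding :: "'s set \<Rightarrow> ('s, 'f) signature \<Rightarrow> 'i set \<Rightarrow>
    ('s, 'f, 'a) alg \<Rightarrow> ('i \<Rightarrow> ('s, 'f, 'b) alg) \<Rightarrow> ('s \<Rightarrow> 'a \<Rightarrow> ('i \<Rightarrow> 'b)) \<Rightarrow> bool" where
  "subdirect_embedding S \<Sigma> I A C f \<longleftrightarrow>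
     monomorphism S \<Sigma> A (prod_alg S \<Sigma> I C) f \<and>
     (\<forall>i\<in>I. sorted_surj S (car A) (car (C i)) (sorted_comp S (car A) (prod_pr S \<Sigma> I C i) f))"


subsection \<open>Congruences, quotients and kernels\<close>

definition Cgr :: "'s set \<Rightarrow> ('s, 'f) signature \<Rightarrow> ('s, 'f, 'a) alg \<Rightarrow> ('s \<Rightarrow> ('a \<times> 'a) set) set" where
  "Cgr S \<Sigma> A = {\<Phi> \<in> extensional S. (\<forall>s\<in>S. equiv (car A s) (\<Phi> s)) \<and>
     (\<forall>w s \<sigma>. is_symbol S \<Sigma> w s \<sigma> \<longrightarrow> (\<forall>xs\<in>tuples (car A) w. \<forall>ys\<in>tuples (car A) w.
       (\<forall>i<length w. (xs ! i, ys ! i) \<in> \<Phi> (w ! i)) \<longrightarrow> (opn A w s \<sigma> xs, opn A w s \<sigma> ys) \<in> \<Phi> s))}"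

definition cgr_le :: "'s set \<Rightarrow> ('s \<Rightarrow> ('a \<times> 'a) set) \<Rightarrow> ('s \<Rightarrow> ('a \<times> 'a) set) \<Rightarrow> bool" where
  "cgr_le S \<Phi> \<Psi> \<longleftrightarrow> (\<forall>s\<in>S. \<Phi> s \<subseteq> \<Psi> s)"

definition cgr_inter :: "'s set \<Rightarrow> ('s \<Rightarrow> ('a \<times> 'a) set) \<Rightarrow> ('s \<Rightarrow> ('a \<times> 'a) set) \<Rightarrow>
    ('s \<Rightarrow> ('a \<times> 'a) set)" where
  "cgr_inter S \<Phi> \<Psi> = (\<lambda>s\<in>S. \<Phi> s \<inter> \<Psi> s)"

definition cgr_filter :: "'s set \<Rightarrow> ('s, 'f) signature \<Rightarrow> ('s, 'f, 'a) alg \<Rightarrow>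
    ('s \<Rightarrow> ('a \<times> 'a) set) set \<Rightarrow> bool" where
  "cgr_filter S \<Sigma> A X \<longleftrightarrow> X \<subseteq> Cgr S \<Sigma> A \<and> X \<noteq> {} \<and>
     (\<forall>\<Phi>\<in>X. \<forall>\<Psi>\<in>X. cgr_inter S \<Phi> \<Psi> \<in> X) \<and>
     (\<forall>\<Phi>\<in>X. \<forall>\<Psi>\<in>Cgr S \<Sigma> A. cgr_le S \<Phi> \<Psi> \<longrightarrow> \<Psi> \<in> X)"

text \<open>
  An operation of the quotient algebra is evaluated on all representatives \<open>xs\<close> of the given
  classes \<open>Xs\<close>; if \<open>\<Phi>\<close> is a congruence, they all give the same class.
\<close>

definition quot_alg :: "'s set \<Rightarrow> ('s, 'f) signature \<Rightarrow> ('s, 'f, 'a) alg \<Rightarrow>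
    ('s \<Rightarrow> ('a \<times> 'a) set) \<Rightarrow> ('s, 'f, 'a set) alg" where
  "quot_alg S \<Sigma> A \<Phi> = mk_alg S \<Sigma> (\<lambda>s. car A s // \<Phi> s)
     (\<lambda>w s \<sigma> Xs. \<Union>xs\<in>{xs. list_all2 (\<in>) xs Xs}. \<Phi> s `` {opn A w s \<sigma> xs})"

definition quot_pr :: "'s set \<Rightarrow> ('s, 'f, 'a) alg \<Rightarrow> ('s \<Rightarrow> ('a \<times> 'a) set) \<Rightarrow>
    ('s \<Rightarrow> 'a \<Rightarrow> 'a set)" where
  "quot_pr S A \<Phi> = (\<lambda>s\<in>S. \<lambda>x\<in>car A s. \<Phi> s `` {x})"

definition Ker :: "'s set \<Rightarrow> ('s, 'f, 'a) alg \<Rightarrow> ('s \<Rightarrow> 'a \<Rightarrow> 'b) \<Rightarrow> ('s \<Rightarrow> ('a \<times> 'a) set)" where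
  "Ker S A f = (\<lambda>s\<in>S. {(x, y). x \<in> car A s \<and> y \<in> car A s \<and> f s x = f s y})"


subsection \<open>The free algebra on a sorted set\<close>

text \<open>
  The free algebra is the algebra of well-sorted terms. Variables carry their sort because the
  components of a sorted set may overlap, and operation symbols carry their arity and coarity
  because the sets \<open>\<Sigma> w s\<close> may overlap.
\<close>

datatype ('s, 'f, 'x) trm = Var 's 'x | Op "'s list" 's 'f "('s, 'f, 'x) trm list"

inductive well_sorted :: "'s set \<Rightarrow> ('s, 'f) signature \<Rightarrow> ('s \<Rightarrow> 'x set) \<Rightarrow> ('s, 'f, 'x) trm \<Rightarrow> 's \<Rightarrow>
    bool" for S \<Sigma> A where
  "s \<in> S \<Longrightarrow> x \<in> A s \<Longrightarrow> well_sorted S \<Sigma> A (Var s x) s"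
| "is_symbol S \<Sigma> w s \<sigma> \<Longrightarrow> list_all2 (well_sorted S \<Sigma> A) ts w \<Longrightarrow> well_sorted S \<Sigma> A (Op w s \<sigma> ts) s"
  monos list_all2_mono

definition term_alg :: "'s set \<Rightarrow> ('s, 'f) signature \<Rightarrow> ('s \<Rightarrow> 'x set) \<Rightarrow>
    ('s, 'f, ('s, 'f, 'x) trm) alg" where
  "term_alg S \<Sigma> A = mk_alg S \<Sigma> (\<lambda>s. {t. well_sorted S \<Sigma> A t s}) Op"


section \<open>Formations\<close>

definition formation_alg :: "'a set set \<Rightarrow> 's set \<Rightarrow> ('s, 'f) signature \<Rightarrow>
    ('s, 'f, 'a) alg set \<Rightarrow> bool" where
  "formation_alg U S \<Sigma> \<F> \<longleftrightarrow> \<F> \<subseteq> Alg U S \<Sigma> \<and> \<F> \<noteq> {} \<and>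
     (\<forall>A\<in>\<F>. \<forall>B\<in>Alg U S \<Sigma>. isomorphic S \<Sigma> A B \<longrightarrow> B \<in> \<F>) \<and>
     (\<forall>B\<in>\<F>. \<forall>A\<in>Alg U S \<Sigma>. (\<exists>f. epimorphism S \<Sigma> B A f) \<longrightarrow> A \<in> \<F>) \<and>
     (\<forall>A\<in>Alg U S \<Sigma>. \<forall>(n :: nat) C. (\<forall>\<alpha><n. C \<alpha> \<in> \<F>) \<and>
        (\<exists>f. subdirect_embedding S \<Sigma> {..<n} A C f) \<longrightarrow> A \<in> \<F>)"

definition formation_cgr :: "'a set set \<Rightarrow> 's set \<Rightarrow> ('s, 'f) signature \<Rightarrow>
    (('s \<Rightarrow> 'a set) \<Rightarrow> ('s \<Rightarrow> (('s, 'f, 'a) trm \<times> ('s, 'f, 'a) trm) set) set) \<Rightarrow> bool" where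
  "formation_cgr U S \<Sigma> \<FF> \<longleftrightarrow> \<FF> \<in> extensional (sorted_sets U S) \<and>
     (\<forall>A\<in>sorted_sets U S. cgr_filter S \<Sigma> (term_alg S \<Sigma> A) (\<FF> A)) \<and>
     (\<forall>A\<in>sorted_sets U S. \<forall>B\<in>sorted_sets U S. \<forall>\<Theta>\<in>\<FF> B.
        \<forall>f\<in>alg_hom S \<Sigma> (term_alg S \<Sigma> A) (term_alg S \<Sigma> B).
          let g = sorted_comp S (car (term_alg S \<Sigma> A)) (quot_pr S (term_alg S \<Sigma> B) \<Theta>) f in
          epimorphism S \<Sigma> (term_alg S \<Sigma> A) (quot_alg S \<Sigma> (term_alg S \<Sigma> B) \<Theta>) g \<longrightarrow>
          Ker S (term_alg S \<Sigma> A) g \<in> \<FF> A)"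

definition Form_Alg :: "'a set set \<Rightarrow> 's set \<Rightarrow> ('s, 'f) signature \<Rightarrow>
    ('s, 'f, 'a) alg set gorder" where
  "Form_Alg U S \<Sigma> = \<lparr>carrier = {\<F>. formation_alg U S \<Sigma> \<F>}, eq = (=), le = (\<subseteq>)\<rparr>"

definition Form_Cgr :: "'a set set \<Rightarrow> 's set \<Rightarrow> ('s, 'f) signature \<Rightarrow>
    (('s \<Rightarrow> 'a set) \<Rightarrow> ('s \<Rightarrow> (('s, 'f, 'a) trm \<times> ('s, 'f, 'a) trm) set) set) gorder" where
  "Form_Cgr U S \<Sigma> = \<lparr>carrier = {\<FF>. formation_cgr U S \<Sigma> \<FF>}, eq = (=),
     le = (\<lambda>\<FF> \<GG>. \<forall>A\<in>sorted_sets U S. \<FF> A \<subseteq> \<GG> A)\<rparr>"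

definition order_isomorphism :: "'a gorder \<Rightarrow> 'b gorder \<Rightarrow> ('a \<Rightarrow> 'b) \<Rightarrow> bool" where
  "order_isomorphism L M h \<longleftrightarrow> bij_betw h (carrier L) (carrier M) \<and> order_emb L M h"

end

theory Submission
  imports Defs
begin

text \<open>
  A formation of algebras \<open>\<F>\<close> corresponds to the kernels of the epimorphisms from term algebras onto
  members of \<open>\<F>\<close>, and a formation of congruences to the algebras that are images of term algebras
  under epimorphisms whose kernels it contains. Term algebras are projective: an epimorphism from
  \<open>\<^bold>T(A)\<close> onto a quotient of \<open>\<^bold>T(B)\<close> factors through \<open>\<^bold>T(B)\<close>. Hence, for a formation of congruences,
  whether the kernel of an epimorphism \<open>\<^bold>T(A) \<rightarrow> C\<close> belongs to it depends only on \<open>C\<close>, and the two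
  assignments are mutually inverse. The set-theoretic point is that term algebras over sorted sets of
  the universe are in bijection with members of the universe, so that every quotient of a term
  algebra is isomorphic to an algebra of \<open>Alg\<close>.
\<close>

section \<open>Small sets\<close>

text \<open>Three points shape the details.

  The elements of \<open>quot_alg\<close> are sets of terms, while members of \<open>Alg\<close>
  have elements in the universe, so a quotient of a term algebra cannot literally be a member of a
  formation of algebras. The arguments therefore use arbitrary epimorphisms and their kernels;
  \<open>quot_alg\<close> appears only where the closure condition of \<open>formation_cgr\<close>
  refers to it.

  Nonemptiness has to be supplied each time, for the filters, for the formations and for
  intersections of formations. On the side of algebras it comes from subdirect embeddings into the
  empty product: every algebra with at most one element in each sort belongs to every formation.
  Since components may be empty, such an algebra need not be the final one; the one used is the
  quotient of a term algebra by its full congruence.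

  Completeness is proved only for formations of algebras, where infima of nonempty sets are
  intersections. It is then carried along the order isomorphism to formations of
  congruences.\<close>

context grothendieck_universe
begin

text \<open>Terms, lists and pairs do not have type \<open>'v\<close>, so size is measured on an
  arbitrary type. Asking for a surjection instead of a bijection makes closure under images
  immediate; an injection is recovered in \<open>small_embedding\<close>.\<close>

definition small :: "'b set \<Rightarrow> bool" where
  "small X \<longleftrightarrow> (\<exists>x f. X = f ` elts x)"

lemma small_elts: "small (elts x)"
  unfolding small_def by (metis image_ident)

lemma small_iff_range: "small X \<longleftrightarrow> X \<in> range elts"
proof
  assume "small X"
  then obtain x f where "X = f ` elts x" unfolding small_def by blast
  then show "X \<in> range elts" using replacement[of f x] by (metis rangeI)
qed (auto simp: small_elts)

lemma small_image: "small X \<Longrightarrow> small (f ` X)"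
  unfolding small_def by (metis image_image)

lemma small_subset:
  assumes "small X" "Y \<subseteq> X"
  shows "small Y"
proof -
  obtain x f where X: "X = f ` elts x" using assms(1) unfolding small_def by blast
  obtain Z where Z: "Z \<subseteq> elts x" "Y = f ` Z"
    using assms(2) unfolding X by (auto simp: subset_image_iff)
  obtain y where "elts ` elts y = Pow (elts x)" using powerset by blast
  then have "Z \<in> elts ` elts y" using Z(1) by simp
  then have "Z \<in> range elts" by (rule rev_subsetD) (rule image_mono, simp)
  then show ?thesis using Z(2) by (auto simp: small_elts intro: small_image)
qed

text \<open>Choosing preimages under the surjection from \<open>elts x\<close> injects
  \<open>X\<close> into the universe; replacement turns the resulting set into one that belongs to
  it.\<close>

lemma small_embedding:
  assumes "small X"
  shows "\<exists>h. inj_on h X \<and> h ` X \<in> range elts"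
proof -
  obtain x f where X: "X = f ` elts x" using assms unfolding small_def by blast
  have "inj_on (inv_into (elts x) f) X" unfolding X by (rule inj_on_inv_into) simp
  moreover have "small (inv_into (elts x) f ` X)" by (rule small_image[OF assms])
  ultimately show ?thesis unfolding small_iff_range by blast
qed

text \<open>Kuratowski pairs: \<open>u a a\<close> is the singleton of \<open>a\<close>. The pairs
  serve to tag elements in \<open>small_UN\<close>.\<close>

lemma ex_pairing:
  "\<exists>(p :: 'v \<Rightarrow> 'v \<Rightarrow> 'v) l r. \<forall>a b. l (p a b) = a \<and> r (p a b) = b"
proof -
  obtain u where u: "\<And>a b. elts (u a b) = {a, b}" using pairing by metis
  define p where "p a b = u (u a a) (u a b)" for a b
  have p_eqD: "a = c \<and> b = d" if "p a b = p c d" for a b c d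
  proof -
    have "{u a a, u a b} = {u c c, u c d}" using that u unfolding p_def by metis
    then have "u a a = u c c \<and> u a b = u c d \<or> u a a = u c d \<and> u a b = u c c"
      by (simp add: doubleton_eq_iff)
    then have "{a, a} = {c, c} \<and> {a, b} = {c, d} \<or> {a, a} = {c, d} \<and> {a, b} = {c, c}"
      using u by metis
    then show ?thesis by (auto simp: doubleton_eq_iff)
  qed
  have "inj (\<lambda>(a, b). p a b)" by (rule injI) (auto dest: p_eqD)
  then have inv: "inv (\<lambda>(a, b). p a b) (p a b) = (a, b)" for a b
    using inv_f_f[of "\<lambda>(a, b). p a b" "(a, b)"] by simp
  show ?thesis
    by (rule exI[of _ p], rule exI[of _ "\<lambda>q. fst (inv (\<lambda>(a, b). p a b) q)"],
        rule exI[of _ "\<lambda>q. snd (inv (\<lambda>(a, b). p a b) q)"]) (simp add: inv)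
qed

text \<open>Each \<open>X i\<close> has its own parametrization \<open>g i\<close>, so the parameter
  sets must be made disjoint before a single function can cover the union. The set
  \<open>P a\<close> is a copy of \<open>elts (x (k a))\<close> tagged by \<open>a\<close>, and
  \<open>V\<close> is the union of these copies; the tag is a parameter of \<open>i\<close> because
  \<open>i\<close> itself need not lie in the universe.\<close>

lemma small_UN:
  assumes "small I" "\<And>i. i \<in> I \<Longrightarrow> small (X i)"
  shows "small (\<Union>i\<in>I. X i)"
proof -
  obtain j k where I: "I = k ` elts j" using assms(1) unfolding small_def by blast
  have "\<forall>i. \<exists>x g. i \<in> I \<longrightarrow> X i = g ` elts x" using assms(2) unfolding small_def by blast
  then obtain x g where X: "\<And>i. i \<in> I \<Longrightarrow> X i = g i ` elts (x i)" by metis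
  obtain p :: "'v \<Rightarrow> 'v \<Rightarrow> 'v" and l r
    where p: "\<And>a b. l (p a b) = a" "\<And>a b. r (p a b) = b" using ex_pairing by metis
  have "\<forall>a. \<exists>y. elts y = p a ` elts (x (k a))" using replacement by blast
  then obtain P where P: "\<And>a. elts (P a) = p a ` elts (x (k a))" by metis
  obtain W where W: "elts W = P ` elts j" using replacement by blast
  obtain V where V: "elts V = (\<Union>z\<in>elts W. elts z)" using union by blast
  have "(\<Union>i\<in>I. X i) = (\<Union>a\<in>elts j. g (k a) ` elts (x (k a)))" using I X by auto
  also have "\<dots> = (\<lambda>q. g (k (l q)) (r q)) ` elts V"
    unfolding V W using P p by (auto simp: image_UN image_image)
  finally show ?thesis by (auto simp: small_elts intro: small_image)
qed

text \<open>The von Neumann numerals are pairwise distinct: \<open>num m\<close> is a member of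
  \<open>num n\<close> for \<open>m < n\<close>, while foundation forbids \<open>num n\<close> to be
  a member of itself.\<close>

lemma small_nat: "small (UNIV :: nat set)"
proof -
  obtain num :: "nat \<Rightarrow> 'v" and w where
    num: "\<And>n. elts (num (Suc n)) = insert (num n) (elts (num n))" and w: "elts w = range num"
    using omega by blast
  have mem: "num m \<in> elts (num n)" if "m < n" for m n
    using that by (induction n) (auto simp: num less_Suc_eq)
  have irrefl: "num n \<notin> elts (num n)" for n
    using wf_not_refl[OF foundation, of "num n"] by simp
  have "inj num" by (rule linorder_injI) (metis mem irrefl)
  then have "inv num ` elts w = UNIV" unfolding w by (metis inj_imp_surj_inv image_inv_f_f)
  then show ?thesis using small_image[OF small_elts, of "inv num" w] by simp
qed

section \<open>From small sets to small sets of terms\<close>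

lemma small_empty: "small {}"
  by (rule small_subset[OF small_image[OF small_nat] empty_subsetI])

lemma small_Un:
  assumes "small X" "small Y"
  shows "small (X \<union> Y)"
proof -
  have "small (\<Union>n\<in>{0, 1 :: nat}. if n = 0 then X else Y)"
    by (rule small_UN[OF small_subset[OF small_nat]]) (auto simp: assms)
  then show ?thesis by (simp add: Un_commute)
qed

lemma small_Times:
  assumes "small X" "small Y"
  shows "small (X \<times> Y)"
proof -
  have eq: "X \<times> Y = (\<Union>x\<in>X. Pair x ` Y)" by auto
  show ?thesis unfolding eq by (rule small_UN[OF assms(1)]) (rule small_image[OF assms(2)])
qed

lemma small_lists:
  assumes "small X"
  shows "small (lists X)"
proof -
  have "small {xs \<in> lists X. length xs = n}" for n
  proof (induction n)
    case 0
    have "small ((\<lambda>_. []) ` (UNIV :: nat set) :: 'b list set)" by (rule small_image[OF small_nat])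
    then show ?case by (rule small_subset) auto
  next
    case (Suc n)
    have "{xs \<in> lists X. length xs = Suc n} \<subseteq>
        (\<lambda>(x, xs). x # xs) ` (X \<times> {xs \<in> lists X. length xs = n})"
      by (auto simp: length_Suc_conv image_iff)
    then show ?case by (rule small_subset[OF small_image[OF small_Times[OF assms Suc]]])
  qed
  then have "small (\<Union>n\<in>UNIV. {xs \<in> lists X. length xs = n})" by (intro small_UN small_nat)
  then show ?thesis by (rule small_subset) auto
qed

text \<open>Terms appear in countably many stages of bounded depth. Each stage is small, and a
  countable union of small sets is small.\<close>

lemma small_terms:
  assumes S: "small S" and \<Sigma>: "\<And>w s. w \<in> lists S \<Longrightarrow> s \<in> S \<Longrightarrow> small (\<Sigma> w s)"
    and A: "\<And>s. s \<in> S \<Longrightarrow> small (A s)"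
  shows "small {t. well_sorted S \<Sigma> A t s}"
proof -
  define V where "V = (\<Union>s\<in>S. A s)"
  define F where "F = (\<Union>w\<in>lists S. \<Union>s\<in>S. \<Sigma> w s)"
  \<comment> \<open>One round of term formation. It ignores sorts and arities and so produces
    ill-sorted terms too, which is harmless because subsets of small sets are small.\<close>
  define G where "G Y = (\<lambda>(s, x). Var s x) ` (S \<times> V) \<union>
    (\<lambda>(w, s, \<sigma>, ts). Op w s \<sigma> ts) ` (lists S \<times> S \<times> F \<times> lists Y)" for Y
  have "small V" unfolding V_def using S A by (rule small_UN)
  moreover have "small F" unfolding F_def by (intro small_UN small_lists S \<Sigma>)
  ultimately have "small (G Y)" if "small Y" for Y
    unfolding G_def using that S by (intro small_Un small_image small_Times small_lists)
  then have "small ((G ^^ n) {})" for n by (induction n) (auto simp: small_empty)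
  then have small: "small (\<Union>n\<in>UNIV. (G ^^ n) {})" by (intro small_UN small_nat)
  have "mono G"
    unfolding G_def by (intro monoI Un_mono image_mono Sigma_mono lists_mono order_refl)
  then have mono: "(G ^^ m) {} \<subseteq> (G ^^ n) {}" if "m \<le> n" for m n
    using funpow_decreasing[of m n G] that by (simp add: bot_fun_def)
  \<comment> \<open>The arguments of an operation may come from different stages; as there are
    finitely many and the stages increase, one stage contains them all.\<close>
  have lists: "\<exists>n. ts \<in> lists ((G ^^ n) {})" if "\<forall>t\<in>set ts. \<exists>n. t \<in> (G ^^ n) {}" for ts
    using that
  proof (induction ts)
    case (Cons t ts)
    then obtain m n where "t \<in> (G ^^ m) {}" "ts \<in> lists ((G ^^ n) {})" by auto
    then have "t # ts \<in> lists ((G ^^ (max m n)) {})"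
      using mono[of m "max m n"] mono[of n "max m n"] by (auto simp: in_lists_conv_set)
    then show ?case by blast
  qed simp
  have "\<exists>n. t \<in> (G ^^ n) {}" if "well_sorted S \<Sigma> A t s" for t s
    using that
  proof (induction rule: well_sorted.induct)
    case (1 s x)
    then have "Var s x \<in> (G ^^ Suc 0) {}" by (auto simp: G_def V_def)
    then show ?case by blast
  next
    case (2 w s \<sigma> ts)
    have "\<forall>t\<in>set ts. \<exists>n. t \<in> (G ^^ n) {}"
      using 2(2) by (auto simp: list_all2_conv_all_nth in_set_conv_nth)
    then obtain n where "ts \<in> lists ((G ^^ n) {})" using lists by blast
    moreover have "w \<in> lists S" "s \<in> S" "\<sigma> \<in> F"
      using 2(1) unfolding F_def is_symbol_def by blast+
    ultimately have "Op w s \<sigma> ts \<in> G ((G ^^ n) {})"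
      unfolding G_def by (intro UnI2 image_eqI[of _ _ "(w, s, \<sigma>, ts)"]) simp_all
    then have "Op w s \<sigma> ts \<in> (G ^^ Suc n) {}" by simp
    then show ?case by blast
  qed
  then show ?thesis by (intro small_subset[OF small]) auto
qed

end


section \<open>Homomorphisms of many-sorted algebras\<close>

lemma tuples_iff:
  "xs \<in> tuples A w \<longleftrightarrow> length xs = length w \<and> (\<forall>i<length w. xs ! i \<in> A (w ! i))"
  by (auto simp: tuples_def list_all2_conv_all_nth)

lemma tuples_restrict: "w \<in> lists S \<Longrightarrow> tuples (restrict A S) w = tuples A w"
  by (auto simp: set_eq_iff tuples_iff in_lists_conv_set)

lemma map2_in_tuples:
  assumes "xs \<in> tuples A w" "w \<in> lists S" "\<And>s x. s \<in> S \<Longrightarrow> x \<in> A s \<Longrightarrow> f s x \<in> B s"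
  shows "map2 f w xs \<in> tuples B w"
  using assms by (auto simp: tuples_iff in_lists_conv_set)

lemma map2_cong_tuples:
  assumes "xs \<in> tuples A w" "w \<in> lists S" "\<And>s x. s \<in> S \<Longrightarrow> x \<in> A s \<Longrightarrow> f s x = g s x"
  shows "map2 f w xs = map2 g w xs"
  using assms by (intro nth_equalityI) (auto simp: tuples_iff in_lists_conv_set)

lemma map2_map2_tuples:
  assumes "xs \<in> tuples A w"
  shows "map2 g w (map2 f w xs) = map2 (\<lambda>s x. g s (f s x)) w xs"
  using assms by (intro nth_equalityI) (auto simp: tuples_iff)

lemma is_symbolD:
  assumes "is_symbol S \<Sigma> w s \<sigma>"
  shows "s \<in> S" "w \<in> lists S" "i < length w \<Longrightarrow> w ! i \<in> S"
  using assms by (auto simp: is_symbol_def in_lists_conv_set)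

lemma algebra_opn_closed:
  assumes "algebra S \<Sigma> A" "is_symbol S \<Sigma> w s \<sigma>" "xs \<in> tuples (car A) w"
  shows "opn A w s \<sigma> xs \<in> car A s"
proof -
  have "opn A w s \<sigma> \<in> tuples (car A) w \<rightarrow>\<^sub>E car A s"
    using assms(1,2) unfolding algebra_def by metis
  then show ?thesis using assms(3) by blast
qed

lemma car_mk_alg: "s \<in> S \<Longrightarrow> car (mk_alg S \<Sigma> A F) s = A s"
  by (simp add: mk_alg_def)

lemma tuples_mk_alg: "w \<in> lists S \<Longrightarrow> tuples (car (mk_alg S \<Sigma> A F)) w = tuples A w"
  by (simp add: mk_alg_def tuples_restrict)

lemma opn_mk_alg:
  "is_symbol S \<Sigma> w s \<sigma> \<Longrightarrow> xs \<in> tuples A w \<Longrightarrow> opn (mk_alg S \<Sigma> A F) w s \<sigma> xs = F w s \<sigma> xs"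
  by (simp add: mk_alg_def)

lemma algebra_mk_alg:
  assumes "\<And>w s \<sigma> xs. is_symbol S \<Sigma> w s \<sigma> \<Longrightarrow> xs \<in> tuples A w \<Longrightarrow> F w s \<sigma> xs \<in> A s"
  shows "algebra S \<Sigma> (mk_alg S \<Sigma> A F)"
  unfolding algebra_def
proof (intro conjI allI)
  show "car (mk_alg S \<Sigma> A F) \<in> extensional S" by (simp add: mk_alg_def)
  fix w s \<sigma>
  show "if is_symbol S \<Sigma> w s \<sigma>
    then opn (mk_alg S \<Sigma> A F) w s \<sigma> \<in> tuples (car (mk_alg S \<Sigma> A F)) w \<rightarrow>\<^sub>E car (mk_alg S \<Sigma> A F) s
    else opn (mk_alg S \<Sigma> A F) w s \<sigma> = undefined"
  proof (cases "is_symbol S \<Sigma> w s \<sigma>")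
    case True
    then have "restrict (F w s \<sigma>) (tuples A w) \<in> tuples A w \<rightarrow>\<^sub>E A s" using assms by auto
    then show ?thesis
      using True is_symbolD[OF True] by (simp add: tuples_mk_alg car_mk_alg) (simp add: mk_alg_def)
  qed (simp add: mk_alg_def)
qed

lemma alg_hom_closed:
  "f \<in> alg_hom S \<Sigma> A B \<Longrightarrow> s \<in> S \<Longrightarrow> x \<in> car A s \<Longrightarrow> f s x \<in> car B s"
  unfolding alg_hom_def sorted_maps_def by blast

lemma alg_hom_opn:
  assumes "f \<in> alg_hom S \<Sigma> A B" "is_symbol S \<Sigma> w s \<sigma>" "xs \<in> tuples (car A) w"
  shows "f s (opn A w s \<sigma> xs) = opn B w s \<sigma> (map2 f w xs)"
  using assms unfolding alg_hom_def by blast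

lemma alg_hom_tuples:
  assumes "f \<in> alg_hom S \<Sigma> A B" "w \<in> lists S" "xs \<in> tuples (car A) w"
  shows "map2 f w xs \<in> tuples (car B) w"
  using assms(3,2) by (rule map2_in_tuples) (rule alg_hom_closed[OF assms(1)])

text \<open>Homomorphisms are extensional both in the sort and in the element. This lemma allows
  each of them to be given by a plain function that is restricted afterwards.\<close>

lemma restrict_alg_hom:
  assumes A: "algebra S \<Sigma> A"
    and f: "\<And>s x. s \<in> S \<Longrightarrow> x \<in> car A s \<Longrightarrow> f s x \<in> car B s"
    and opn: "\<And>w s \<sigma> xs. is_symbol S \<Sigma> w s \<sigma> \<Longrightarrow> xs \<in> tuples (car A) w \<Longrightarrow>
      f s (opn A w s \<sigma> xs) = opn B w s \<sigma> (map2 f w xs)"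
  shows "(\<lambda>s\<in>S. \<lambda>x\<in>car A s. f s x) \<in> alg_hom S \<Sigma> A B"
  unfolding alg_hom_def
proof (intro CollectI conjI allI impI ballI)
  show "(\<lambda>s\<in>S. \<lambda>x\<in>car A s. f s x) \<in> sorted_maps S (car A) (car B)"
    using f by (auto simp: sorted_maps_def)
  fix w s \<sigma> xs
  assume *: "is_symbol S \<Sigma> w s \<sigma>" "xs \<in> tuples (car A) w"
  have eq: "map2 (\<lambda>s\<in>S. \<lambda>x\<in>car A s. f s x) w xs = map2 f w xs"
    using *(2) is_symbolD(2)[OF *(1)] by (rule map2_cong_tuples) simp
  show "(\<lambda>s\<in>S. \<lambda>x\<in>car A s. f s x) s (opn A w s \<sigma> xs) =
      opn B w s \<sigma> (map2 (\<lambda>s\<in>S. \<lambda>x\<in>car A s. f s x) w xs)"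
    unfolding eq opn[OF *, symmetric]
    using algebra_opn_closed[OF A *] is_symbolD(1)[OF *(1)] by simp
qed

lemma sorted_comp_apply: "s \<in> S \<Longrightarrow> x \<in> A s \<Longrightarrow> sorted_comp S A g f s x = g s (f s x)"
  by (simp add: sorted_comp_def compose_def)

lemma sorted_comp_alg_hom:
  assumes A: "algebra S \<Sigma> A" and f: "f \<in> alg_hom S \<Sigma> A B" and g: "g \<in> alg_hom S \<Sigma> B C"
  shows "sorted_comp S (car A) g f \<in> alg_hom S \<Sigma> A C"
  unfolding sorted_comp_def compose_def
proof (rule restrict_alg_hom[OF A])
  show "g s (f s x) \<in> car C s" if "s \<in> S" "x \<in> car A s" for s x
    using that alg_hom_closed[OF f] alg_hom_closed[OF g] by metis
  fix w s \<sigma> xs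
  assume *: "is_symbol S \<Sigma> w s \<sigma>" "xs \<in> tuples (car A) w"
  show "g s (f s (opn A w s \<sigma> xs)) = opn C w s \<sigma> (map2 (\<lambda>s x. g s (f s x)) w xs)"
    using alg_hom_opn[OF f *] alg_hom_opn[OF g *(1) alg_hom_tuples[OF f is_symbolD(2)[OF *(1)] *(2)]]
    by (simp add: map2_map2_tuples[OF *(2)])
qed

lemma epimorphism_alg_hom: "epimorphism S \<Sigma> A B f \<Longrightarrow> f \<in> alg_hom S \<Sigma> A B"
  by (simp add: epimorphism_def)

lemma epimorphism_image: "epimorphism S \<Sigma> A B f \<Longrightarrow> s \<in> S \<Longrightarrow> f s ` car A s = car B s"
  by (simp add: epimorphism_def sorted_surj_def)

lemma epimorphismI:
  "f \<in> alg_hom S \<Sigma> A B \<Longrightarrow> (\<And>s. s \<in> S \<Longrightarrow> f s ` car A s = car B s) \<Longrightarrow> epimorphism S \<Sigma> A B f"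
  by (simp add: epimorphism_def sorted_surj_def)

lemma sorted_comp_image:
  "s \<in> S \<Longrightarrow> sorted_comp S A g f s ` A s = g s ` f s ` A s"
  by (auto simp: sorted_comp_apply image_iff)

lemma sorted_comp_epimorphism:
  assumes "algebra S \<Sigma> A" "epimorphism S \<Sigma> A B f" "epimorphism S \<Sigma> B C g"
  shows "epimorphism S \<Sigma> A C (sorted_comp S (car A) g f)"
proof (rule epimorphismI)
  show "sorted_comp S (car A) g f \<in> alg_hom S \<Sigma> A C"
    using assms by (intro sorted_comp_alg_hom epimorphism_alg_hom)
  show "sorted_comp S (car A) g f s ` car A s = car C s" if "s \<in> S" for s
    using that epimorphism_image[OF assms(2)] epimorphism_image[OF assms(3)]
    by (simp add: sorted_comp_image)
qed

section \<open>Lifting tuples and factoring homomorphisms along epimorphisms\<close>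

lemma epimorphism_tuples:
  assumes g: "epimorphism S \<Sigma> A C g" and w: "w \<in> lists S" and ys: "ys \<in> tuples (car C) w"
  obtains xs where "xs \<in> tuples (car A) w" "map2 g w xs = ys"
proof
  have inv: "inv_into (car A s) (g s) y \<in> car A s" "g s (inv_into (car A s) (g s) y) = y"
    if "s \<in> S" "y \<in> car C s" for s y
    using that epimorphism_image[OF g that(1)] by (auto intro: inv_into_into f_inv_into_f)
  let ?xs = "map2 (\<lambda>s. inv_into (car A s) (g s)) w ys"
  show "?xs \<in> tuples (car A) w" using ys w inv(1) by (rule map2_in_tuples)
  have "map2 g w ?xs = map2 (\<lambda>s y. y) w ys"
    unfolding map2_map2_tuples[OF ys] using ys w inv(2) by (rule map2_cong_tuples)
  also have "\<dots> = ys" using ys by (intro nth_equalityI) (auto simp: tuples_iff)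
  finally show "map2 g w ?xs = ys" .
qed

text \<open>The homomorphism theorem. By \<open>ker\<close>, the value of \<open>h\<close> at a
  chosen preimage under \<open>g\<close> does not depend on the choice, and an operation of
  \<open>C\<close> is computed by lifting its arguments to \<open>A\<close>.\<close>

lemma epimorphism_factor:
  assumes C: "algebra S \<Sigma> C"
    and A: "algebra S \<Sigma> A"
    and g: "epimorphism S \<Sigma> A C g" and h: "h \<in> alg_hom S \<Sigma> A D"
    and ker: "\<And>s x y. s \<in> S \<Longrightarrow> x \<in> car A s \<Longrightarrow> y \<in> car A s \<Longrightarrow> g s x = g s y \<Longrightarrow> h s x = h s y"
  obtains k where "k \<in> alg_hom S \<Sigma> C D" "\<And>s x. s \<in> S \<Longrightarrow> x \<in> car A s \<Longrightarrow> k s (g s x) = h s x"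
proof
  define k where "k s y = h s (inv_into (car A s) (g s) y)" for s y
  note gc = alg_hom_closed[OF epimorphism_alg_hom[OF g]]
  have kg: "k s (g s x) = h s x" if "s \<in> S" "x \<in> car A s" for s x
    unfolding k_def using that by (intro ker) (auto intro: inv_into_into f_inv_into_f)
  have kc: "k s y \<in> car D s" if "s \<in> S" "y \<in> car C s" for s y
  proof -
    have "y \<in> g s ` car A s" using that epimorphism_image[OF g] by simp
    then obtain x where "x \<in> car A s" "y = g s x" by blast
    then show ?thesis using kg that alg_hom_closed[OF h] by simp
  qed
  let ?k = "\<lambda>s\<in>S. \<lambda>y\<in>car C s. k s y"
  show "?k \<in> alg_hom S \<Sigma> C D"
  proof (rule restrict_alg_hom[OF C kc])
    fix w s \<sigma> ys
    assume *: "is_symbol S \<Sigma> w s \<sigma>" "ys \<in> tuples (car C) w"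
    note w = is_symbolD(2)[OF *(1)]
    obtain xs where xs: "xs \<in> tuples (car A) w" "map2 g w xs = ys"
      using epimorphism_tuples[OF g w *(2)] .
    have "map2 k w ys = map2 (\<lambda>s x. k s (g s x)) w xs"
      unfolding xs(2)[symmetric] by (rule map2_map2_tuples[OF xs(1)])
    also have "\<dots> = map2 h w xs" using xs(1) w kg by (rule map2_cong_tuples)
    finally have "opn D w s \<sigma> (map2 k w ys) = h s (opn A w s \<sigma> xs)"
      using alg_hom_opn[OF h *(1) xs(1)] by simp
    moreover have "opn C w s \<sigma> ys = g s (opn A w s \<sigma> xs)"
      using alg_hom_opn[OF epimorphism_alg_hom[OF g] *(1) xs(1)] xs(2) by simp
    ultimately show "k s (opn C w s \<sigma> ys) = opn D w s \<sigma> (map2 k w ys)"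
      using kg[OF is_symbolD(1)[OF *(1)] algebra_opn_closed[OF A *(1) xs(1)]] by simp
  qed
  show "?k s (g s x) = h s x" if "s \<in> S" "x \<in> car A s" for s x
    using that kg gc by simp
qed

lemma epimorphism_factor_epimorphism:
  assumes "algebra S \<Sigma> C" "algebra S \<Sigma> A"
    and g: "epimorphism S \<Sigma> A C g" and h: "epimorphism S \<Sigma> A D h"
    and "\<And>s x y. s \<in> S \<Longrightarrow> x \<in> car A s \<Longrightarrow> y \<in> car A s \<Longrightarrow> g s x = g s y \<Longrightarrow> h s x = h s y"
  obtains k where "epimorphism S \<Sigma> C D k" "\<And>s x. s \<in> S \<Longrightarrow> x \<in> car A s \<Longrightarrow> k s (g s x) = h s x"
proof -
  obtain k where k: "k \<in> alg_hom S \<Sigma> C D" "\<And>s x. s \<in> S \<Longrightarrow> x \<in> car A s \<Longrightarrow> k s (g s x) = h s x"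
    by (rule epimorphism_factor[OF assms(1,2) g epimorphism_alg_hom[OF h]]) (use assms(5) in blast)+
  have "k s ` car C s = car D s" if "s \<in> S" for s
  proof -
    have "k s ` car C s = h s ` car A s"
      unfolding epimorphism_image[OF g that, symmetric] image_image
      using k(2)[OF that] by simp
    then show ?thesis using epimorphism_image[OF h that] by simp
  qed
  with k(1) have "epimorphism S \<Sigma> C D k" by (rule epimorphismI)
  then show thesis using k(2) by (rule that)
qed


section \<open>Congruences and quotients\<close>

lemma mem_Ker_iff:
  "s \<in> S \<Longrightarrow> (x, y) \<in> Ker S A f s \<longleftrightarrow> x \<in> car A s \<and> y \<in> car A s \<and> f s x = f s y"
  by (simp add: Ker_def)

lemma Cgr_equiv: "\<Phi> \<in> Cgr S \<Sigma> A \<Longrightarrow> s \<in> S \<Longrightarrow> equiv (car A s) (\<Phi> s)"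
  unfolding Cgr_def by blast

lemma Cgr_subset: "\<Phi> \<in> Cgr S \<Sigma> A \<Longrightarrow> s \<in> S \<Longrightarrow> \<Phi> s \<subseteq> car A s \<times> car A s"
  by (rule equiv_type[OF Cgr_equiv])

lemma Cgr_opn:
  assumes "\<Phi> \<in> Cgr S \<Sigma> A" "is_symbol S \<Sigma> w s \<sigma>" "xs \<in> tuples (car A) w" "ys \<in> tuples (car A) w"
    "\<And>i. i < length w \<Longrightarrow> (xs ! i, ys ! i) \<in> \<Phi> (w ! i)"
  shows "(opn A w s \<sigma> xs, opn A w s \<sigma> ys) \<in> \<Phi> s"
  using assms unfolding Cgr_def by blast

lemma Ker_in_Cgr:
  assumes A: "algebra S \<Sigma> A" and f: "f \<in> alg_hom S \<Sigma> A B"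
  shows "Ker S A f \<in> Cgr S \<Sigma> A"
  unfolding Cgr_def
proof (intro CollectI conjI ballI allI impI)
  show "Ker S A f \<in> extensional S" by (simp add: Ker_def)
  show "equiv (car A s) (Ker S A f s)" if "s \<in> S" for s
    using that by (auto simp: Ker_def equiv_def refl_on_def sym_def trans_def)
  fix w s \<sigma> xs ys
  assume *: "is_symbol S \<Sigma> w s \<sigma>" "xs \<in> tuples (car A) w" "ys \<in> tuples (car A) w"
    and rel: "\<forall>i<length w. (xs ! i, ys ! i) \<in> Ker S A f (w ! i)"
  have "map2 f w xs = map2 f w ys"
    using *(2,3) rel is_symbolD(3)[OF *(1)]
    by (intro nth_equalityI) (auto simp: tuples_iff mem_Ker_iff)
  then show "(opn A w s \<sigma> xs, opn A w s \<sigma> ys) \<in> Ker S A f s"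
    using * alg_hom_opn[OF f *(1,2)] alg_hom_opn[OF f *(1,3)]
    by (simp add: mem_Ker_iff is_symbolD(1) algebra_opn_closed[OF A])
qed

lemma Ker_eqI:
  assumes "\<Theta> \<in> Cgr S \<Sigma> A"
    and "\<And>s x y. s \<in> S \<Longrightarrow> x \<in> car A s \<Longrightarrow> y \<in> car A s \<Longrightarrow> f s x = f s y \<longleftrightarrow> (x, y) \<in> \<Theta> s"
  shows "Ker S A f = \<Theta>"
proof (rule extensionalityI)
  show "Ker S A f \<in> extensional S" by (simp add: Ker_def)
  show "\<Theta> \<in> extensional S" using assms(1) by (simp add: Cgr_def)
  show "Ker S A f s = \<Theta> s" if "s \<in> S" for s
    using that assms(2) Cgr_subset[OF assms(1) that] by (auto simp: mem_Ker_iff)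
qed

text \<open>
  The labels \<open>e s x\<close> stand for the classes of \<open>\<Theta>\<close>, which allows the quotient to live on the type of the universe.
\<close>

lemma ex_quotient:
  assumes A: "algebra S \<Sigma> A" and \<Theta>: "\<Theta> \<in> Cgr S \<Sigma> A"
    and e: "\<And>s x y. s \<in> S \<Longrightarrow> x \<in> car A s \<Longrightarrow> y \<in> car A s \<Longrightarrow> e s x = e s y \<longleftrightarrow> (x, y) \<in> \<Theta> s"
  obtains C q where "algebra S \<Sigma> C" "car C = (\<lambda>s\<in>S. e s ` car A s)"
    "epimorphism S \<Sigma> A C q" "Ker S A q = \<Theta>"
proof -
  define r where "r s = inv_into (car A s) (e s)" for s
  define C where "C = mk_alg S \<Sigma> (\<lambda>s. e s ` car A s) (\<lambda>w s \<sigma> ys. e s (opn A w s \<sigma> (map2 r w ys)))"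
  define q where "q = (\<lambda>s\<in>S. \<lambda>x\<in>car A s. e s x)"
  have r: "r s y \<in> car A s" "e s (r s y) = y" if "y \<in> e s ` car A s" for s y
    unfolding r_def using that by (rule inv_into_into, rule f_inv_into_f)
  have rt: "map2 r w ys \<in> tuples (car A) w" if "ys \<in> tuples (\<lambda>s. e s ` car A s) w" "w \<in> lists S"
    for w ys using that r(1) by (rule map2_in_tuples)
  have C: "algebra S \<Sigma> C"
    unfolding C_def
    by (intro algebra_mk_alg imageI algebra_opn_closed[OF A] rt is_symbolD(2))
  have car: "car C = (\<lambda>s\<in>S. e s ` car A s)" by (simp add: C_def mk_alg_def)
  have "q \<in> alg_hom S \<Sigma> A C"
    unfolding q_def
  proof (rule restrict_alg_hom[OF A])
    show "e s x \<in> car C s" if "s \<in> S" "x \<in> car A s" for s x using that by (simp add: car)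
    fix w s \<sigma> xs
    assume *: "is_symbol S \<Sigma> w s \<sigma>" "xs \<in> tuples (car A) w"
    note w = is_symbolD(2)[OF *(1)]
    have et: "map2 e w xs \<in> tuples (\<lambda>s. e s ` car A s) w"
      using *(2) w by (rule map2_in_tuples) simp
    \<comment> \<open>The operation of \<open>C\<close> is evaluated on the representatives
      \<open>r (e x)\<close> rather than on \<open>x\<close>; the two are congruent in each
      coordinate, so compatibility of \<open>\<Theta>\<close> applies.\<close>
    have "(opn A w s \<sigma> xs, opn A w s \<sigma> (map2 r w (map2 e w xs))) \<in> \<Theta> s"
    proof (rule Cgr_opn[OF \<Theta> * rt[OF et w]])
      fix i assume i: "i < length w"
      then have x: "xs ! i \<in> car A (w ! i)" "length xs = length w" using *(2) by (auto simp: tuples_iff)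
      then show "(xs ! i, map2 r w (map2 e w xs) ! i) \<in> \<Theta> (w ! i)"
        using i r is_symbolD(3)[OF *(1) i]
        by (simp add: e[symmetric])
    qed
    then have "e s (opn A w s \<sigma> xs) = e s (opn A w s \<sigma> (map2 r w (map2 e w xs)))"
      using e is_symbolD(1)[OF *(1)] * rt[OF et w] by (simp add: algebra_opn_closed[OF A])
    then show "e s (opn A w s \<sigma> xs) = opn C w s \<sigma> (map2 e w xs)"
      unfolding C_def opn_mk_alg[OF *(1) et] .
  qed
  then have "epimorphism S \<Sigma> A C q" by (rule epimorphismI) (simp add: car q_def)
  moreover have "Ker S A q = \<Theta>" using e by (intro Ker_eqI[OF \<Theta>]) (simp add: q_def)
  ultimately show thesis using C car that by blast
qed

lemma quot_pr_epimorphism: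
  assumes A: "algebra S \<Sigma> A" and \<Theta>: "\<Theta> \<in> Cgr S \<Sigma> A"
  shows "epimorphism S \<Sigma> A (quot_alg S \<Sigma> A \<Theta>) (quot_pr S A \<Theta>)"
proof (rule epimorphismI)
  show "quot_pr S A \<Theta> \<in> alg_hom S \<Sigma> A (quot_alg S \<Sigma> A \<Theta>)"
    unfolding quot_pr_def
  proof (rule restrict_alg_hom[OF A])
    show "\<Theta> s `` {x} \<in> car (quot_alg S \<Sigma> A \<Theta>) s" if "s \<in> S" "x \<in> car A s" for s x
      using that by (simp add: quot_alg_def car_mk_alg quotientI)
    fix w s \<sigma> xs
    assume *: "is_symbol S \<Sigma> w s \<sigma>" "xs \<in> tuples (car A) w"
    note w = is_symbolD(2)[OF *(1)]
    let ?Xs = "map2 (\<lambda>s x. \<Theta> s `` {x}) w xs"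
    have Xs: "?Xs \<in> tuples (\<lambda>s. car A s // \<Theta> s) w"
      using *(2) w by (rule map2_in_tuples) (rule quotientI)
    have len: "length xs = length w" using *(2) by (simp add: tuples_iff)
    \<comment> \<open>All tuples of representatives yield the same class. As \<open>xs\<close> is
      itself such a tuple, the union in \<open>quot_alg\<close> is over a nonempty constant family
      and equals that class.\<close>
    have "\<Theta> s `` {opn A w s \<sigma> ys} = \<Theta> s `` {opn A w s \<sigma> xs}" if ys: "list_all2 (\<in>) ys ?Xs" for ys
    proof -
      have rel: "(xs ! i, ys ! i) \<in> \<Theta> (w ! i)" if "i < length w" for i
        using ys that len by (auto simp: list_all2_conv_all_nth)
      have "ys \<in> tuples (car A) w"
        using ys len rel Cgr_subset[OF \<Theta> is_symbolD(3)[OF *(1)]]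
        by (fastforce simp: tuples_iff list_all2_conv_all_nth)
      then have "(opn A w s \<sigma> xs, opn A w s \<sigma> ys) \<in> \<Theta> s" using Cgr_opn[OF \<Theta> *] rel by blast
      then show ?thesis
        using equiv_class_eq[OF Cgr_equiv[OF \<Theta> is_symbolD(1)[OF *(1)]]] by metis
    qed
    moreover have "list_all2 (\<in>) xs ?Xs"
    proof -
      have "xs ! i \<in> \<Theta> (w ! i) `` {xs ! i}" if "i < length w" for i
        using that *(2) equiv_class_self[OF Cgr_equiv[OF \<Theta> is_symbolD(3)[OF *(1)]]]
        by (simp add: tuples_iff)
      then show ?thesis using len by (simp add: list_all2_conv_all_nth)
    qed
    ultimately have "(\<Union>ys\<in>{ys. list_all2 (\<in>) ys ?Xs}. \<Theta> s `` {opn A w s \<sigma> ys}) =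
        \<Theta> s `` {opn A w s \<sigma> xs}" by blast
    then show "\<Theta> s `` {opn A w s \<sigma> xs} = opn (quot_alg S \<Sigma> A \<Theta>) w s \<sigma> ?Xs"
      unfolding quot_alg_def opn_mk_alg[OF *(1) Xs] by (rule sym)
  qed
  show "quot_pr S A \<Theta> s ` car A s = car (quot_alg S \<Sigma> A \<Theta>) s" if "s \<in> S" for s
    using that by (auto simp: quot_pr_def quot_alg_def car_mk_alg quotient_def)
qed

lemma quot_pr_eq_iff:
  assumes "\<Theta> \<in> Cgr S \<Sigma> A" "s \<in> S" "x \<in> car A s" "y \<in> car A s"
  shows "quot_pr S A \<Theta> s x = quot_pr S A \<Theta> s y \<longleftrightarrow> (x, y) \<in> \<Theta> s"
  using assms eq_equiv_class_iff[OF Cgr_equiv[OF assms(1,2)] assms(3,4)] by (simp add: quot_pr_def)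


section \<open>The universal property of the term algebra\<close>

lemma car_term_alg: "s \<in> S \<Longrightarrow> car (term_alg S \<Sigma> A) s = {t. well_sorted S \<Sigma> A t s}"
  by (simp add: term_alg_def car_mk_alg)

lemma tuples_term_alg:
  assumes "w \<in> lists S"
  shows "ts \<in> tuples (car (term_alg S \<Sigma> A)) w \<longleftrightarrow> list_all2 (well_sorted S \<Sigma> A) ts w"
  unfolding term_alg_def tuples_mk_alg[OF assms] by (simp add: tuples_def)

lemma opn_term_alg:
  assumes "is_symbol S \<Sigma> w s \<sigma>" "ts \<in> tuples (car (term_alg S \<Sigma> A)) w"
  shows "opn (term_alg S \<Sigma> A) w s \<sigma> ts = Op w s \<sigma> ts"
  using assms(2) unfolding term_alg_def tuples_mk_alg[OF is_symbolD(2)[OF assms(1)]]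
  by (rule opn_mk_alg[OF assms(1)])

lemma algebra_term_alg: "algebra S \<Sigma> (term_alg S \<Sigma> A)"
  unfolding term_alg_def
  by (rule algebra_mk_alg) (simp add: tuples_def well_sorted.intros(2))

text \<open>No sort argument is needed, since variables and operations carry their sorts; one
  function evaluates terms of all sorts.\<close>

primrec trm_eval :: "('s, 'f, 'b) alg \<Rightarrow> ('s \<Rightarrow> 'a \<Rightarrow> 'b) \<Rightarrow> ('s, 'f, 'a) trm \<Rightarrow> 'b" where
  "trm_eval D \<phi> (Var s x) = \<phi> s x"
| "trm_eval D \<phi> (Op w s \<sigma> ts) = opn D w s \<sigma> (map (trm_eval D \<phi>) ts)"

lemma ex_term_alg_hom:
  assumes D: "algebra S \<Sigma> D" and \<phi>: "\<And>s x. s \<in> S \<Longrightarrow> x \<in> A s \<Longrightarrow> \<phi> s x \<in> car D s"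
  obtains f where "f \<in> alg_hom S \<Sigma> (term_alg S \<Sigma> A) D"
    "\<And>s x. s \<in> S \<Longrightarrow> x \<in> A s \<Longrightarrow> f s (Var s x) = \<phi> s x"
proof
  let ?T = "term_alg S \<Sigma> A"
  let ?f = "\<lambda>s\<in>S. \<lambda>t\<in>car ?T s. trm_eval D \<phi> t"
  have eval: "trm_eval D \<phi> t \<in> car D s" if "well_sorted S \<Sigma> A t s" for t s
    using that
  proof (induction rule: well_sorted.induct)
    case (2 w s \<sigma> ts)
    then have "map (trm_eval D \<phi>) ts \<in> tuples (car D) w"
      by (auto simp: tuples_iff list_all2_conv_all_nth)
    then show ?case using algebra_opn_closed[OF D 2(1)] by simp
  qed (simp add: \<phi>)
  show "?f \<in> alg_hom S \<Sigma> ?T D"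
  proof (rule restrict_alg_hom[OF algebra_term_alg])
    show "trm_eval D \<phi> t \<in> car D s" if "s \<in> S" "t \<in> car ?T s" for s t
      using that eval by (simp add: car_term_alg)
    fix w s \<sigma> ts
    assume *: "is_symbol S \<Sigma> w s \<sigma>" "ts \<in> tuples (car ?T) w"
    have "map2 (\<lambda>s. trm_eval D \<phi>) w ts = map (trm_eval D \<phi>) ts"
      using *(2) by (intro nth_equalityI) (auto simp: tuples_iff)
    then show "trm_eval D \<phi> (opn ?T w s \<sigma> ts) = opn D w s \<sigma> (map2 (\<lambda>s. trm_eval D \<phi>) w ts)"
      by (simp add: opn_term_alg[OF *])
  qed
  show "?f s (Var s x) = \<phi> s x" if "s \<in> S" "x \<in> A s" for s x
    using that by (simp add: car_term_alg well_sorted.intros(1))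
qed

lemma term_alg_hom_eq:
  assumes f: "f \<in> alg_hom S \<Sigma> (term_alg S \<Sigma> A) D" and g: "g \<in> alg_hom S \<Sigma> (term_alg S \<Sigma> A) D"
    and eq: "\<And>s x. s \<in> S \<Longrightarrow> x \<in> A s \<Longrightarrow> f s (Var s x) = g s (Var s x)"
    and t: "s \<in> S" "t \<in> car (term_alg S \<Sigma> A) s"
  shows "f s t = g s t"
proof -
  have "well_sorted S \<Sigma> A t s" using t by (simp add: car_term_alg)
  then show ?thesis
  proof (induction rule: well_sorted.induct)
    case (2 w s \<sigma> ts)
    have ts: "ts \<in> tuples (car (term_alg S \<Sigma> A)) w"
      unfolding tuples_term_alg[OF is_symbolD(2)[OF 2(1)]]
      using 2(2) by (rule list_all2_mono) simp
    have eq: "map2 f w ts = map2 g w ts"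
      using 2(2) by (intro nth_equalityI) (auto simp: list_all2_conv_all_nth)
    show ?case
      using alg_hom_opn[OF f 2(1) ts] alg_hom_opn[OF g 2(1) ts]
      unfolding eq opn_term_alg[OF 2(1) ts] by simp
  qed (simp add: eq)
qed

text \<open>It suffices to choose preimages under \<open>p\<close> of the values of \<open>g\<close>
  on variables: the homomorphism extending this choice, followed by \<open>p\<close>, agrees with
  \<open>g\<close> on variables and hence on all terms.\<close>

lemma term_alg_projective:
  assumes D: "algebra S \<Sigma> D" and p: "epimorphism S \<Sigma> D C p"
    and g: "g \<in> alg_hom S \<Sigma> (term_alg S \<Sigma> A) C"
  obtains f where "f \<in> alg_hom S \<Sigma> (term_alg S \<Sigma> A) D"
    "\<And>s t. s \<in> S \<Longrightarrow> t \<in> car (term_alg S \<Sigma> A) s \<Longrightarrow> p s (f s t) = g s t"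
proof -
  let ?T = "term_alg S \<Sigma> A"
  have var: "Var s x \<in> car ?T s" if "s \<in> S" "x \<in> A s" for s x
    using that by (simp add: car_term_alg well_sorted.intros(1))
  define \<phi> where "\<phi> s x = inv_into (car D s) (p s) (g s (Var s x))" for s x
  have \<phi>: "\<phi> s x \<in> car D s" "p s (\<phi> s x) = g s (Var s x)" if "s \<in> S" "x \<in> A s" for s x
  proof -
    have "g s (Var s x) \<in> p s ` car D s"
      using alg_hom_closed[OF g] var that epimorphism_image[OF p] by metis
    then show "\<phi> s x \<in> car D s" "p s (\<phi> s x) = g s (Var s x)"
      unfolding \<phi>_def by (rule inv_into_into, rule f_inv_into_f)
  qed
  obtain f where f: "f \<in> alg_hom S \<Sigma> ?T D" "\<And>s x. s \<in> S \<Longrightarrow> x \<in> A s \<Longrightarrow> f s (Var s x) = \<phi> s x"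
    by (rule ex_term_alg_hom[OF D, of A \<phi>]) (use \<phi>(1) in blast)+
  have pf: "sorted_comp S (car ?T) p f \<in> alg_hom S \<Sigma> ?T C"
    by (rule sorted_comp_alg_hom[OF algebra_term_alg f(1) epimorphism_alg_hom[OF p]])
  have "p s (f s t) = g s t" if "s \<in> S" "t \<in> car ?T s" for s t
    using term_alg_hom_eq[OF pf g _ that] that by (simp add: sorted_comp_apply var f(2) \<phi>(2))
  with f(1) show thesis by (rule that)
qed

text \<open>Evaluation of terms whose variables are the elements of \<open>D\<close>; the variable
  \<open>x\<close> already maps to \<open>x\<close>. For \<open>D\<close> in \<open>Alg\<close> the
  variables form a sorted set of the universe.\<close>

lemma ex_term_alg_epimorphism:
  assumes "algebra S \<Sigma> D"
  obtains p where "epimorphism S \<Sigma> (term_alg S \<Sigma> (car D)) D p"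
proof -
  let ?T = "term_alg S \<Sigma> (car D)"
  obtain p where p: "p \<in> alg_hom S \<Sigma> ?T D" "\<And>s x. s \<in> S \<Longrightarrow> x \<in> car D s \<Longrightarrow> p s (Var s x) = x"
    by (rule ex_term_alg_hom[OF assms, of "car D" "\<lambda>s x. x"]) blast+
  have "p s ` car ?T s = car D s" if s: "s \<in> S" for s
  proof
    show "p s ` car ?T s \<subseteq> car D s" using alg_hom_closed[OF p(1) s] by blast
    show "car D s \<subseteq> p s ` car ?T s"
    proof
      fix x assume "x \<in> car D s"
      then show "x \<in> p s ` car ?T s"
        using s p(2) by (intro image_eqI[of _ _ "Var s x"]) (simp_all add: car_term_alg well_sorted.intros(1))
    qed
  qed
  with p(1) show thesis by (intro that epimorphismI)
qed


section \<open>Subdirect embeddings as jointly injective families of epimorphisms\<close>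

lemma opn_prod_alg:
  assumes "is_symbol S \<Sigma> w s \<sigma>" "xs \<in> tuples (car (prod_alg S \<Sigma> I C)) w"
  shows "opn (prod_alg S \<Sigma> I C) w s \<sigma> xs = (\<lambda>i\<in>I. opn (C i) w s \<sigma> (map (\<lambda>x. x i) xs))"
  using assms(2) unfolding prod_alg_def tuples_mk_alg[OF is_symbolD(2)[OF assms(1)]]
  by (rule opn_mk_alg[OF assms(1)])

lemma car_prod_alg: "s \<in> S \<Longrightarrow> car (prod_alg S \<Sigma> I C) s = (\<Pi>\<^sub>E i\<in>I. car (C i) s)"
  by (simp add: prod_alg_def car_mk_alg)

text \<open>A homomorphism into a product is the family of its components, and it is injective iff
  they jointly separate elements. For empty \<open>I\<close> the right side says that every sort has
  at most one element.\<close>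

lemma ex_subdirect_embedding_iff:
  assumes A: "algebra S \<Sigma> A"
  shows "(\<exists>f. subdirect_embedding S \<Sigma> I A C f) \<longleftrightarrow>
    (\<exists>k. (\<forall>i\<in>I. epimorphism S \<Sigma> A (C i) (k i)) \<and>
      (\<forall>s\<in>S. \<forall>x\<in>car A s. \<forall>y\<in>car A s. (\<forall>i\<in>I. k i s x = k i s y) \<longrightarrow> x = y))"
    (is "?L \<longleftrightarrow> ?R")
proof
  let ?P = "prod_alg S \<Sigma> I C"
  assume ?L
  then obtain f where f: "f \<in> alg_hom S \<Sigma> A ?P" "sorted_inj S (car A) f"
    and surj: "\<And>i. i \<in> I \<Longrightarrow>
      sorted_surj S (car A) (car (C i)) (sorted_comp S (car A) (prod_pr S \<Sigma> I C i) f)"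
    unfolding subdirect_embedding_def monomorphism_def by blast
  define k where "k i = (\<lambda>s\<in>S. \<lambda>x\<in>car A s. f s x i)" for i
  have fc: "f s x \<in> (\<Pi>\<^sub>E i\<in>I. car (C i) s)" if "s \<in> S" "x \<in> car A s" for s x
    using alg_hom_closed[OF f(1) that] that by (simp add: car_prod_alg)
  have "epimorphism S \<Sigma> A (C i) (k i)" if i: "i \<in> I" for i
  proof (rule epimorphismI)
    show "k i \<in> alg_hom S \<Sigma> A (C i)"
      unfolding k_def
    proof (rule restrict_alg_hom[OF A])
      show "f s x i \<in> car (C i) s" if "s \<in> S" "x \<in> car A s" for s x
        using fc[OF that] i by blast
      fix w s \<sigma> xs
      assume *: "is_symbol S \<Sigma> w s \<sigma>" "xs \<in> tuples (car A) w"
      have eq: "map (\<lambda>x. x i) (map2 f w xs) = map2 (\<lambda>s x. f s x i) w xs"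
        by (simp add: case_prod_beta comp_def)
      show "f s (opn A w s \<sigma> xs) i = opn (C i) w s \<sigma> (map2 (\<lambda>s x. f s x i) w xs)"
        unfolding alg_hom_opn[OF f(1) *] eq[symmetric]
          opn_prod_alg[OF *(1) alg_hom_tuples[OF f(1) is_symbolD(2)[OF *(1)] *(2)]]
        by (rule restrict_apply'[OF i])
    qed
    fix s assume s: "s \<in> S"
    have "k i s ` car A s = sorted_comp S (car A) (prod_pr S \<Sigma> I C i) f s ` car A s"
      using s alg_hom_closed[OF f(1) s]
      by (intro image_cong) (simp_all add: k_def sorted_comp_apply prod_pr_def)
    then show "k i s ` car A s = car (C i) s"
      using surj[OF i] s by (simp add: sorted_surj_def)
  qed
  moreover have "x = y"
    if "s \<in> S" "x \<in> car A s" "y \<in> car A s" "\<forall>i\<in>I. k i s x = k i s y" for s x y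
  proof -
    \<comment> \<open>Both values are extensional on \<open>I\<close>, so agreement of the
      coordinates in \<open>I\<close> is enough.\<close>
    have "f s x = f s y"
      using fc[OF that(1,2)] fc[OF that(1,3)] that by (intro PiE_ext) (auto simp: k_def)
    then show ?thesis using f(2) that unfolding sorted_inj_def inj_on_def by blast
  qed
  ultimately show ?R by blast
next
  let ?P = "prod_alg S \<Sigma> I C"
  assume ?R
  then obtain k where k: "\<And>i. i \<in> I \<Longrightarrow> epimorphism S \<Sigma> A (C i) (k i)"
    and inj: "\<And>s x y. s \<in> S \<Longrightarrow> x \<in> car A s \<Longrightarrow> y \<in> car A s \<Longrightarrow> (\<forall>i\<in>I. k i s x = k i s y) \<Longrightarrow> x = y"
    by blast
  note kh = epimorphism_alg_hom[OF k]
  define g where "g s x = (\<lambda>i\<in>I. k i s x)" for s x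
  define f where "f = (\<lambda>s\<in>S. \<lambda>x\<in>car A s. g s x)"
  have gc: "g s x \<in> car ?P s" if "s \<in> S" "x \<in> car A s" for s x
    using that alg_hom_closed[OF kh] by (simp add: car_prod_alg g_def)
  have "f \<in> alg_hom S \<Sigma> A ?P"
    unfolding f_def
  proof (rule restrict_alg_hom[OF A gc])
    fix w s \<sigma> xs
    assume *: "is_symbol S \<Sigma> w s \<sigma>" "xs \<in> tuples (car A) w"
    note w = is_symbolD(2)[OF *(1)]
    have gt: "map2 g w xs \<in> tuples (car ?P) w" using *(2) w gc by (rule map2_in_tuples)
    have eq: "map (\<lambda>x. x i) (map2 g w xs) = map2 (k i) w xs" if "i \<in> I" for i
      using that by (simp add: g_def case_prod_beta comp_def)
    have "k i s (opn A w s \<sigma> xs) = opn (C i) w s \<sigma> (map (\<lambda>x. x i) (map2 g w xs))" if "i \<in> I" for i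
      unfolding eq[OF that] by (rule alg_hom_opn[OF kh[OF that] *])
    then show "g s (opn A w s \<sigma> xs) = opn ?P w s \<sigma> (map2 g w xs)"
      unfolding opn_prod_alg[OF *(1) gt] g_def[of s "opn A w s \<sigma> xs"] by (rule restrict_ext)
  qed
  moreover have "sorted_inj S (car A) f"
    unfolding sorted_inj_def
  proof (intro ballI inj_onI)
    fix s x y
    assume *: "s \<in> S" "x \<in> car A s" "y \<in> car A s" "f s x = f s y"
    then have "g s x = g s y" by (simp add: f_def)
    then have "\<forall>i\<in>I. k i s x = k i s y" unfolding g_def by (metis restrict_apply')
    then show "x = y" by (rule inj[OF *(1-3)])
  qed
  moreover have "sorted_surj S (car A) (car (C i)) (sorted_comp S (car A) (prod_pr S \<Sigma> I C i) f)"
    if i: "i \<in> I" for i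
    unfolding sorted_surj_def
  proof
    fix s assume s: "s \<in> S"
    have "sorted_comp S (car A) (prod_pr S \<Sigma> I C i) f s ` car A s = k i s ` car A s"
      using s i gc by (intro image_cong) (simp_all add: sorted_comp_apply prod_pr_def f_def g_def)
    then show "sorted_comp S (car A) (prod_pr S \<Sigma> I C i) f s ` car A s = car (C i) s"
      using epimorphism_image[OF k[OF i] s] by simp
  qed
  ultimately show ?L unfolding subdirect_embedding_def monomorphism_def by blast
qed


section \<open>Formations of algebras and formations of congruences\<close>

lemma Ker_cong:
  "(\<And>s x. s \<in> S \<Longrightarrow> x \<in> car A s \<Longrightarrow> f s x = g s x) \<Longrightarrow> Ker S A f = Ker S A g"
  unfolding Ker_def by (intro restrict_ext) auto

text \<open>The top of \<open>Cgr\<close>. Its quotient has one element in exactly those sorts in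
  which \<open>A\<close> is inhabited.\<close>

lemma full_congruence:
  "algebra S \<Sigma> A \<Longrightarrow> (\<lambda>s\<in>S. car A s \<times> car A s) \<in> Cgr S \<Sigma> A"
  unfolding Cgr_def
  by (auto simp: is_symbolD(1) algebra_opn_closed equiv_def refl_on_def sym_def trans_def)

lemma cgr_inter_in_Cgr:
  assumes "\<Phi> \<in> Cgr S \<Sigma> A" "\<Psi> \<in> Cgr S \<Sigma> A"
  shows "cgr_inter S \<Phi> \<Psi> \<in> Cgr S \<Sigma> A"
  unfolding Cgr_def
proof (intro CollectI conjI ballI allI impI)
  show "cgr_inter S \<Phi> \<Psi> \<in> extensional S" by (simp add: cgr_inter_def)
  show "equiv (car A s) (cgr_inter S \<Phi> \<Psi> s)" if s: "s \<in> S" for s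
  proof (rule equivI)
    note eq = Cgr_equiv[OF assms(1) s] Cgr_equiv[OF assms(2) s]
    show "cgr_inter S \<Phi> \<Psi> s \<subseteq> car A s \<times> car A s"
      using s Cgr_subset[OF assms(1) s] by (auto simp: cgr_inter_def)
    show "refl_on (car A s) (cgr_inter S \<Phi> \<Psi> s)"
      using s eq[THEN equivE] by (auto simp: cgr_inter_def refl_on_def)
    show "sym (cgr_inter S \<Phi> \<Psi> s)"
      using s eq by (auto simp: cgr_inter_def equiv_def intro: sym_Int)
    show "trans (cgr_inter S \<Phi> \<Psi> s)"
      using s eq by (auto simp: cgr_inter_def equiv_def intro: trans_Int)
  qed
  fix w s \<sigma> xs ys
  assume *: "is_symbol S \<Sigma> w s \<sigma>" "xs \<in> tuples (car A) w" "ys \<in> tuples (car A) w"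
    "\<forall>i<length w. (xs ! i, ys ! i) \<in> cgr_inter S \<Phi> \<Psi> (w ! i)"
  then show "(opn A w s \<sigma> xs, opn A w s \<sigma> ys) \<in> cgr_inter S \<Phi> \<Psi> s"
    using is_symbolD[OF *(1)] Cgr_opn[OF assms(1) *(1-3)] Cgr_opn[OF assms(2) *(1-3)]
    by (simp add: cgr_inter_def)
qed

lemma Ker_eqD:
  assumes "Ker S B p = Ker S B g" "s \<in> S" "x \<in> car B s" "y \<in> car B s"
  shows "p s x = p s y \<longleftrightarrow> g s x = g s y"
  using assms mem_Ker_iff[of s S x y B p] mem_Ker_iff[of s S x y B g] by simp

text \<open>Epimorphisms with equal kernels identify the same elements, so whether the composite
  with \<open>f\<close> is onto, and what its kernel is, depends on that kernel alone. This
  exchanges a quotient \<open>T(B)/\<Theta>\<close> for an algebra over the universe and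
  back.\<close>

lemma Ker_comp_eq_epimorphism:
  assumes A: "algebra S \<Sigma> A"
    and p: "epimorphism S \<Sigma> B P p" and g: "epimorphism S \<Sigma> B C g"
    and ker: "Ker S B p = Ker S B g"
    and f: "f \<in> alg_hom S \<Sigma> A B"
    and pf: "epimorphism S \<Sigma> A P (sorted_comp S (car A) p f)"
  shows "epimorphism S \<Sigma> A C (sorted_comp S (car A) g f)"
    and "Ker S A (sorted_comp S (car A) p f) = Ker S A (sorted_comp S (car A) g f)"
proof -
  note fc = alg_hom_closed[OF f]
  show "epimorphism S \<Sigma> A C (sorted_comp S (car A) g f)"
  proof (rule epimorphismI)
    show gf: "sorted_comp S (car A) g f \<in> alg_hom S \<Sigma> A C"
      by (rule sorted_comp_alg_hom[OF A f epimorphism_alg_hom[OF g]])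
    fix s assume s: "s \<in> S"
    show "sorted_comp S (car A) g f s ` car A s = car C s"
    proof
      show "sorted_comp S (car A) g f s ` car A s \<subseteq> car C s"
        using alg_hom_closed[OF gf s] by blast
      show "car C s \<subseteq> sorted_comp S (car A) g f s ` car A s"
      proof
        fix z assume "z \<in> car C s"
        then obtain y where y: "y \<in> car B s" "z = g s y" using epimorphism_image[OF g s] by blast
        then have "p s y \<in> car P s" using alg_hom_closed[OF epimorphism_alg_hom[OF p] s] by blast
        \<comment> \<open>Surjectivity of the composite with \<open>p\<close> only reaches
          \<open>y\<close> up to \<open>p\<close>; equality of the kernels turns this into equality
          under \<open>g\<close>.\<close>
        then obtain x where x: "x \<in> car A s" "p s y = p s (f s x)"
          using epimorphism_image[OF pf s] s by (auto simp: sorted_comp_image)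
        then have "z = g s (f s x)" using y Ker_eqD[OF ker s y(1) fc[OF s x(1)]] by simp
        then show "z \<in> sorted_comp S (car A) g f s ` car A s"
          using x(1) s by (simp add: sorted_comp_image)
      qed
    qed
  qed
  show "Ker S A (sorted_comp S (car A) p f) = Ker S A (sorted_comp S (car A) g f)"
    unfolding Ker_def
    using Ker_eqD[OF ker] fc by (intro restrict_ext) (auto simp: sorted_comp_apply)
qed

section \<open>The closure conditions in terms of epimorphisms and kernels\<close>

lemma formation_alg_epimorphism:
  assumes "formation_alg U S \<Sigma> \<F>" "B \<in> \<F>" "A \<in> Alg U S \<Sigma>" "epimorphism S \<Sigma> B A f"
  shows "A \<in> \<F>"
  using assms unfolding formation_alg_def by blast

lemma formation_alg_subset: "formation_alg U S \<Sigma> \<F> \<Longrightarrow> \<F> \<subseteq> Alg U S \<Sigma>"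
  by (simp add: formation_alg_def)

lemma Alg_algebra: "A \<in> Alg U S \<Sigma> \<Longrightarrow> algebra S \<Sigma> A"
  by (simp add: Alg_def)

lemma Alg_car: "A \<in> Alg U S \<Sigma> \<Longrightarrow> car A \<in> sorted_sets U S"
  by (simp add: Alg_def)

text \<open>By \<open>eq\<close>, the kernel of \<open>q\<close> is the intersection of the kernels
  of the \<open>g \<alpha>\<close>. So each \<open>g \<alpha>\<close> factors through
  \<open>q\<close>, and the factors \<open>k \<alpha>\<close> are jointly injective on
  \<open>D\<close>, which makes \<open>D\<close> a subdirect product of the
  \<open>C \<alpha>\<close>.\<close>

lemma formation_alg_subdirect:
  fixes n :: nat
  assumes \<F>: "formation_alg U S \<Sigma> \<F>" and D: "D \<in> Alg U S \<Sigma>" and A: "algebra S \<Sigma> A"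
    and q: "epimorphism S \<Sigma> A D q"
    and C: "\<And>\<alpha>. \<alpha> < n \<Longrightarrow> C \<alpha> \<in> \<F>" and g: "\<And>\<alpha>. \<alpha> < n \<Longrightarrow> epimorphism S \<Sigma> A (C \<alpha>) (g \<alpha>)"
    and eq: "\<And>s x y. s \<in> S \<Longrightarrow> x \<in> car A s \<Longrightarrow> y \<in> car A s \<Longrightarrow>
      q s x = q s y \<longleftrightarrow> (\<forall>\<alpha><n. g \<alpha> s x = g \<alpha> s y)"
  shows "D \<in> \<F>"
proof -
  have "\<exists>k. epimorphism S \<Sigma> D (C \<alpha>) k \<and> (\<forall>s\<in>S. \<forall>x\<in>car A s. k s (q s x) = g \<alpha> s x)"
    if "\<alpha> < n" for \<alpha>
  proof -
    note g\<alpha> = g[OF that]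
    obtain k where "epimorphism S \<Sigma> D (C \<alpha>) k"
      "\<And>s x. s \<in> S \<Longrightarrow> x \<in> car A s \<Longrightarrow> k s (q s x) = g \<alpha> s x"
      by (rule epimorphism_factor_epimorphism[OF Alg_algebra[OF D] A q g\<alpha>])
        (use eq \<open>\<alpha> < n\<close> in blast)+
    then show ?thesis by blast
  qed
  then obtain k where k: "\<And>\<alpha>. \<alpha> < n \<Longrightarrow> epimorphism S \<Sigma> D (C \<alpha>) (k \<alpha>)"
    "\<And>\<alpha> s x. \<alpha> < n \<Longrightarrow> s \<in> S \<Longrightarrow> x \<in> car A s \<Longrightarrow> k \<alpha> s (q s x) = g \<alpha> s x"
    by metis
  have "u = v" if *: "s \<in> S" "u \<in> car D s" "v \<in> car D s" "\<forall>\<alpha>\<in>{..<n}. k \<alpha> s u = k \<alpha> s v" for s u v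
  proof -
    obtain x y where xy: "x \<in> car A s" "u = q s x" "y \<in> car A s" "v = q s y"
      using *(2,3) unfolding epimorphism_image[OF q *(1), symmetric] by blast
    then have "g \<alpha> s x = g \<alpha> s y" if "\<alpha> < n" for \<alpha>
      using k(2)[OF that *(1)] *(4) that by (metis lessThan_iff)
    then show ?thesis using eq[OF *(1) xy(1,3)] xy(2,4) by blast
  qed
  then have "\<exists>f. subdirect_embedding S \<Sigma> {..<n} D C f"
    unfolding ex_subdirect_embedding_iff[OF Alg_algebra[OF D]] using k(1) by blast
  then show ?thesis using \<F> D C unfolding formation_alg_def by blast
qed

lemma formation_cgr_filter:
  "formation_cgr U S \<Sigma> \<FF> \<Longrightarrow> A \<in> sorted_sets U S \<Longrightarrow> cgr_filter S \<Sigma> (term_alg S \<Sigma> A) (\<FF> A)"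
  by (simp add: formation_cgr_def)

text \<open>
  In the closure condition of a formation of congruences, the projection onto \<open>\<^bold>T(B)/\<Theta>\<close> may be
  replaced by any other epimorphism with kernel \<open>\<Theta>\<close>.
\<close>

lemma formation_cgr_comp:
  assumes \<FF>: "formation_cgr U S \<Sigma> \<FF>" and AB: "A \<in> sorted_sets U S" "B \<in> sorted_sets U S"
    and g: "epimorphism S \<Sigma> (term_alg S \<Sigma> B) C g" and ker: "Ker S (term_alg S \<Sigma> B) g \<in> \<FF> B"
    and f: "f \<in> alg_hom S \<Sigma> (term_alg S \<Sigma> A) (term_alg S \<Sigma> B)"
    and gf: "epimorphism S \<Sigma> (term_alg S \<Sigma> A) C (sorted_comp S (car (term_alg S \<Sigma> A)) g f)"
  shows "Ker S (term_alg S \<Sigma> A) (sorted_comp S (car (term_alg S \<Sigma> A)) g f) \<in> \<FF> A"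
proof -
  let ?A = "term_alg S \<Sigma> A" and ?B = "term_alg S \<Sigma> B"
  let ?\<Theta> = "Ker S ?B g"
  have \<Theta>: "?\<Theta> \<in> Cgr S \<Sigma> ?B" by (rule Ker_in_Cgr[OF algebra_term_alg epimorphism_alg_hom[OF g]])
  note p = quot_pr_epimorphism[OF algebra_term_alg \<Theta>]
  have "Ker S ?B (quot_pr S ?B ?\<Theta>) = ?\<Theta>" by (rule Ker_eqI[OF \<Theta>]) (rule quot_pr_eq_iff[OF \<Theta>])
  note * = Ker_comp_eq_epimorphism[OF algebra_term_alg g p this[symmetric] f gf]
  have "Ker S ?A (sorted_comp S (car ?A) (quot_pr S ?B ?\<Theta>) f) \<in> \<FF> A"
    using \<FF> AB ker f *(1) unfolding formation_cgr_def Let_def by blast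
  then show ?thesis by (simp add: *(2))
qed

text \<open>Sorts and symbols may have any type, as only smallness matters; over \<open>'v\<close>
  it amounts to membership in the universe by \<open>small_iff_range\<close>.\<close>

locale small_signature = grothendieck_universe elts
  for elts :: "'v \<Rightarrow> 'v set" +
  fixes S :: "'s set" and \<Sigma> :: "('s, 'f) signature"
  assumes small_sorts: "small S"
    and small_symbols: "\<And>w s. w \<in> lists S \<Longrightarrow> s \<in> S \<Longrightarrow> small (\<Sigma> w s)"
begin

abbreviation U :: "'v set set" where "U \<equiv> range elts"

abbreviation T :: "('s \<Rightarrow> 'v set) \<Rightarrow> ('s, 'f, ('s, 'f, 'v) trm) alg" where
  "T \<equiv> term_alg S \<Sigma>"

text \<open>In each sort the terms, and hence the classes of \<open>\<Theta>\<close>, form a small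
  set. An injection \<open>h s\<close> codes the classes by elements of the universe, and the
  quotient is built on the codes.\<close>

lemma ex_Alg_quotient:
  assumes A: "A \<in> sorted_sets U S" and \<Theta>: "\<Theta> \<in> Cgr S \<Sigma> (T A)"
  obtains C q where "C \<in> Alg U S \<Sigma>" "epimorphism S \<Sigma> (T A) C q" "Ker S (T A) q = \<Theta>"
proof -
  have "\<exists>h. inj_on h (car (T A) s // \<Theta> s) \<and> h ` (car (T A) s // \<Theta> s) \<in> U" if "s \<in> S" for s
  proof -
    have "small (A r)" if "r \<in> S" for r
      using A that unfolding sorted_sets_def small_iff_range by blast
    then have "small (car (T A) s)"
      unfolding car_term_alg[OF that] using small_sorts small_symbols by (intro small_terms)
    then have "small ((\<lambda>x. \<Theta> s `` {x}) ` car (T A) s)" by (rule small_image)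
    moreover have "(\<lambda>x. \<Theta> s `` {x}) ` car (T A) s = car (T A) s // \<Theta> s"
      by (auto simp: quotient_def)
    ultimately show ?thesis using small_embedding by metis
  qed
  then obtain h where h: "\<And>s. s \<in> S \<Longrightarrow> inj_on (h s) (car (T A) s // \<Theta> s)"
    "\<And>s. s \<in> S \<Longrightarrow> h s ` (car (T A) s // \<Theta> s) \<in> U" by metis
  define e where "e s x = h s (\<Theta> s `` {x})" for s x
  have e: "e s x = e s y \<longleftrightarrow> (x, y) \<in> \<Theta> s"
    if "s \<in> S" "x \<in> car (T A) s" "y \<in> car (T A) s" for s x y
    unfolding e_def inj_on_eq_iff[OF h(1)[OF that(1)] quotientI[OF that(2)] quotientI[OF that(3)]]
    by (rule eq_equiv_class_iff[OF Cgr_equiv[OF \<Theta> that(1)] that(2,3)])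
  have im: "e s ` car (T A) s \<in> U" if "s \<in> S" for s
  proof -
    have "e s ` car (T A) s = h s ` (car (T A) s // \<Theta> s)"
      by (auto simp: e_def quotient_def)
    then show ?thesis using h(2)[OF that] by simp
  qed
  obtain C q where C: "algebra S \<Sigma> C" "car C = (\<lambda>s\<in>S. e s ` car (T A) s)"
    and q: "epimorphism S \<Sigma> (T A) C q" "Ker S (T A) q = \<Theta>"
    by (rule ex_quotient[OF algebra_term_alg \<Theta> e]) blast+
  have "C \<in> Alg U S \<Sigma>" using C im by (simp add: Alg_def sorted_sets_def)
  then show thesis using q by (rule that)
qed

section \<open>The two assignments and their properties\<close>

lemma empty_in_sorted_sets: "(\<lambda>s\<in>S. {}) \<in> sorted_sets U S"
  using small_iff_range[of "{}"] small_empty unfolding sorted_sets_def restrict_PiE_iff by blast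

text \<open>This expresses that \<open>T(A)/\<Theta>\<close> belongs to \<open>\<F>\<close> up to
  isomorphism: \<open>\<Theta>\<close> is the kernel of an epimorphism onto a member of
  \<open>\<F>\<close>.\<close>

definition congruences_of ::
    "('s, 'f, 'v) alg set \<Rightarrow> ('s \<Rightarrow> 'v set) \<Rightarrow> ('s \<Rightarrow> (('s, 'f, 'v) trm \<times> ('s, 'f, 'v) trm) set) set"
  where "congruences_of \<F> =
    (\<lambda>A\<in>sorted_sets U S. {Ker S (T A) g | C g. C \<in> \<F> \<and> epimorphism S \<Sigma> (T A) C g})"

text \<open>One epimorphism from one term algebra is required; by
  \<open>Ker_mem_formation_cgr\<close> all others then have the same property.\<close>

definition algebras_of ::
    "(('s \<Rightarrow> 'v set) \<Rightarrow> ('s \<Rightarrow> (('s, 'f, 'v) trm \<times> ('s, 'f, 'v) trm) set) set) \<Rightarrow>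
      ('s, 'f, 'v) alg set"
  where "algebras_of \<FF> = {C \<in> Alg U S \<Sigma>. \<exists>A\<in>sorted_sets U S. \<exists>g.
    epimorphism S \<Sigma> (T A) C g \<and> Ker S (T A) g \<in> \<FF> A}"

lemma mem_congruences_of_iff:
  "A \<in> sorted_sets U S \<Longrightarrow> \<Theta> \<in> congruences_of \<F> A \<longleftrightarrow>
    (\<exists>C g. C \<in> \<F> \<and> epimorphism S \<Sigma> (T A) C g \<and> \<Theta> = Ker S (T A) g)"
  by (auto simp: congruences_of_def)

text \<open>Here \<open>C\<close> has at most one element in each sort and so embeds subdirectly
  into the empty product. With \<open>n = 0\<close> the families passed to the rule are mere
  placeholders.\<close>

lemma full_quotient_in_formation:
  assumes "formation_alg U S \<Sigma> \<F>" "C \<in> Alg U S \<Sigma>" "epimorphism S \<Sigma> (T A) C q"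
    "Ker S (T A) q = (\<lambda>s\<in>S. car (T A) s \<times> car (T A) s)"
  shows "C \<in> \<F>"
proof (rule formation_alg_subdirect[OF assms(1,2) algebra_term_alg assms(3),
      where n = 0 and C = "\<lambda>_. C" and g = "\<lambda>_. q"])
  fix s x y
  assume *: "s \<in> S" "x \<in> car (T A) s" "y \<in> car (T A) s"
  then have "(x, y) \<in> Ker S (T A) q s" unfolding assms(4) by simp
  then show "q s x = q s y \<longleftrightarrow> (\<forall>\<alpha><(0 :: nat). q s x = q s y)"
    using * by (simp add: mem_Ker_iff)
qed simp_all

text \<open>The conditions correspond one by one: empty subdirect products make the filter nonempty,
  binary ones give intersections, and epimorphic images give upward closure. The condition on
  homomorphisms holds because the composite again maps onto the same \<open>C\<close>.\<close>

lemma congruences_of_formation_cgr: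
  assumes \<F>: "formation_alg U S \<Sigma> \<F>"
  shows "formation_cgr U S \<Sigma> (congruences_of \<F>)"
  unfolding formation_cgr_def
proof (intro conjI ballI)
  show "congruences_of \<F> \<in> extensional (sorted_sets U S)" by (simp add: congruences_of_def)
next
  fix A assume A: "A \<in> sorted_sets U S"
  note TA = algebra_term_alg[of S \<Sigma> A]
  show "cgr_filter S \<Sigma> (T A) (congruences_of \<F> A)"
    unfolding cgr_filter_def
  proof (intro conjI ballI impI)
    show "congruences_of \<F> A \<subseteq> Cgr S \<Sigma> (T A)"
      by (auto simp: mem_congruences_of_iff[OF A] intro: Ker_in_Cgr[OF TA epimorphism_alg_hom])
    obtain C q where C: "C \<in> Alg U S \<Sigma>" "epimorphism S \<Sigma> (T A) C q"
      "Ker S (T A) q = (\<lambda>s\<in>S. car (T A) s \<times> car (T A) s)"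
      by (rule ex_Alg_quotient[OF A full_congruence[OF TA]])
    have "C \<in> \<F>" by (rule full_quotient_in_formation[OF \<F> C])
    then have "Ker S (T A) q \<in> congruences_of \<F> A"
      unfolding mem_congruences_of_iff[OF A] using C(2) by blast
    then show "congruences_of \<F> A \<noteq> {}" by blast
  next
    fix \<Phi> \<Psi>
    assume "\<Phi> \<in> congruences_of \<F> A" "\<Psi> \<in> congruences_of \<F> A"
    then obtain C g D h where C: "C \<in> \<F>" "epimorphism S \<Sigma> (T A) C g" "\<Phi> = Ker S (T A) g"
      and D: "D \<in> \<F>" "epimorphism S \<Sigma> (T A) D h" "\<Psi> = Ker S (T A) h"
      unfolding mem_congruences_of_iff[OF A] by blast
    have "\<Phi> \<in> Cgr S \<Sigma> (T A)" "\<Psi> \<in> Cgr S \<Sigma> (T A)"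
      unfolding C(3) D(3)
      by (fact Ker_in_Cgr[OF TA epimorphism_alg_hom[OF C(2)]]
        Ker_in_Cgr[OF TA epimorphism_alg_hom[OF D(2)]])+
    from ex_Alg_quotient[OF A cgr_inter_in_Cgr[OF this]]
    obtain E q where E: "E \<in> Alg U S \<Sigma>" "epimorphism S \<Sigma> (T A) E q"
      "Ker S (T A) q = cgr_inter S \<Phi> \<Psi>" .
    have "E \<in> \<F>"
    proof (rule formation_alg_subdirect[OF \<F> E(1) TA E(2), where n = 2
          and C = "\<lambda>\<alpha>. if \<alpha> = 0 then C else D" and g = "\<lambda>\<alpha>. if \<alpha> = 0 then g else h"])
      fix s x y
      assume *: "s \<in> S" "x \<in> car (T A) s" "y \<in> car (T A) s"
      have "q s x = q s y \<longleftrightarrow> (x, y) \<in> cgr_inter S \<Phi> \<Psi> s"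
        using * by (simp add: E(3)[symmetric] mem_Ker_iff)
      also have "\<dots> \<longleftrightarrow> g s x = g s y \<and> h s x = h s y"
        using * by (simp add: C(3) D(3) cgr_inter_def mem_Ker_iff)
      finally show "q s x = q s y \<longleftrightarrow>
          (\<forall>\<alpha><2. (if \<alpha> = (0 :: nat) then g else h) s x = (if \<alpha> = 0 then g else h) s y)"
        by (auto simp: less_2_cases_iff)
    qed (simp_all add: C D)
    then show "cgr_inter S \<Phi> \<Psi> \<in> congruences_of \<F> A"
      unfolding mem_congruences_of_iff[OF A] using E by metis
  next
    fix \<Phi> \<Psi>
    assume "\<Phi> \<in> congruences_of \<F> A" and \<Psi>: "\<Psi> \<in> Cgr S \<Sigma> (T A)" and le: "cgr_le S \<Phi> \<Psi>"
    then obtain C g where C: "C \<in> \<F>" "epimorphism S \<Sigma> (T A) C g" "\<Phi> = Ker S (T A) g"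
      unfolding mem_congruences_of_iff[OF A] by blast
    obtain D h where D: "D \<in> Alg U S \<Sigma>" "epimorphism S \<Sigma> (T A) D h" "Ker S (T A) h = \<Psi>"
      by (rule ex_Alg_quotient[OF A \<Psi>])
    have "h s x = h s y" if "s \<in> S" "x \<in> car (T A) s" "y \<in> car (T A) s" "g s x = g s y" for s x y
    proof -
      have "(x, y) \<in> \<Phi> s" unfolding C(3) using that by (simp add: mem_Ker_iff)
      then have "(x, y) \<in> Ker S (T A) h s" using le that(1) unfolding cgr_le_def D(3) by blast
      then show ?thesis using that(1) by (simp add: mem_Ker_iff)
    qed
    moreover have "algebra S \<Sigma> C" using C(1) formation_alg_subset[OF \<F>] Alg_algebra by blast
    ultimately obtain k where "epimorphism S \<Sigma> C D k"
      using epimorphism_factor_epimorphism[OF _ TA C(2) D(2)] by blast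
    then have "D \<in> \<F>" by (rule formation_alg_epimorphism[OF \<F> C(1) D(1)])
    then show "\<Psi> \<in> congruences_of \<F> A"
      unfolding mem_congruences_of_iff[OF A] using D by metis
  qed
next
  fix A B \<Theta> f
  assume A: "A \<in> sorted_sets U S" and B: "B \<in> sorted_sets U S"
    and \<Theta>: "\<Theta> \<in> congruences_of \<F> B" and f: "f \<in> alg_hom S \<Sigma> (T A) (T B)"
  obtain C g where C: "C \<in> \<F>" and g: "epimorphism S \<Sigma> (T B) C g" and ker: "\<Theta> = Ker S (T B) g"
    using \<Theta> unfolding mem_congruences_of_iff[OF B] by blast
  have cgr: "\<Theta> \<in> Cgr S \<Sigma> (T B)"
    unfolding ker by (rule Ker_in_Cgr[OF algebra_term_alg epimorphism_alg_hom[OF g]])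
  note p = quot_pr_epimorphism[OF algebra_term_alg cgr]
  have eq: "Ker S (T B) (quot_pr S (T B) \<Theta>) = Ker S (T B) g"
    unfolding ker[symmetric] by (rule Ker_eqI[OF cgr]) (rule quot_pr_eq_iff[OF cgr])
  show "let h = sorted_comp S (car (T A)) (quot_pr S (T B) \<Theta>) f in
    epimorphism S \<Sigma> (T A) (quot_alg S \<Sigma> (T B) \<Theta>) h \<longrightarrow> Ker S (T A) h \<in> congruences_of \<F> A"
    unfolding Let_def mem_congruences_of_iff[OF A]
    using Ker_comp_eq_epimorphism[OF algebra_term_alg p g eq f] C by blast
qed

text \<open>Membership of \<open>C\<close> provides some \<open>h\<close> from \<open>T(B)\<close>
  onto \<open>C\<close> with kernel in \<open>\<FF> B\<close>. Projectivity gives \<open>f\<close>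
  with \<open>h\<close> after \<open>f\<close> equal to \<open>g\<close>, and the closure condition
  transports the kernel from \<open>B\<close> to \<open>A\<close>.\<close>

lemma Ker_mem_formation_cgr:
  assumes \<FF>: "formation_cgr U S \<Sigma> \<FF>" and A: "A \<in> sorted_sets U S"
    and C: "C \<in> algebras_of \<FF>" and g: "epimorphism S \<Sigma> (T A) C g"
  shows "Ker S (T A) g \<in> \<FF> A"
proof -
  obtain B h where B: "B \<in> sorted_sets U S" and h: "epimorphism S \<Sigma> (T B) C h"
    and ker: "Ker S (T B) h \<in> \<FF> B"
    using C unfolding algebras_of_def by blast
  obtain f where f: "f \<in> alg_hom S \<Sigma> (T A) (T B)"
    "\<And>s t. s \<in> S \<Longrightarrow> t \<in> car (T A) s \<Longrightarrow> h s (f s t) = g s t"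
    by (rule term_alg_projective[OF algebra_term_alg h epimorphism_alg_hom[OF g]]) blast
  have hf: "sorted_comp S (car (T A)) h f s t = g s t" if "s \<in> S" "t \<in> car (T A) s" for s t
    using that f(2) by (simp add: sorted_comp_apply)
  have "epimorphism S \<Sigma> (T A) C (sorted_comp S (car (T A)) h f)"
  proof (rule epimorphismI)
    show "sorted_comp S (car (T A)) h f \<in> alg_hom S \<Sigma> (T A) C"
      by (rule sorted_comp_alg_hom[OF algebra_term_alg f(1) epimorphism_alg_hom[OF h]])
    show "sorted_comp S (car (T A)) h f s ` car (T A) s = car C s" if "s \<in> S" for s
      using epimorphism_image[OF g that] hf[OF that] by simp
  qed
  then have "Ker S (T A) (sorted_comp S (car (T A)) h f) \<in> \<FF> A"
    by (rule formation_cgr_comp[OF \<FF> A B h ker f(1)])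
  then show ?thesis using Ker_cong[of S "T A" "sorted_comp S (car (T A)) h f" g] hf by simp
qed

text \<open>Composing with \<open>e\<close> can only enlarge the kernel, and filters are upward
  closed.\<close>

lemma algebras_of_epimorphism:
  assumes \<FF>: "formation_cgr U S \<Sigma> \<FF>" and C: "C \<in> algebras_of \<FF>"
    and D: "D \<in> Alg U S \<Sigma>" and e: "epimorphism S \<Sigma> C D e"
  shows "D \<in> algebras_of \<FF>"
proof -
  obtain A g where A: "A \<in> sorted_sets U S" and g: "epimorphism S \<Sigma> (T A) C g"
    and ker: "Ker S (T A) g \<in> \<FF> A"
    using C unfolding algebras_of_def by blast
  let ?h = "sorted_comp S (car (T A)) e g"
  have h: "epimorphism S \<Sigma> (T A) D ?h" by (rule sorted_comp_epimorphism[OF algebra_term_alg g e])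
  then have "Ker S (T A) ?h \<in> Cgr S \<Sigma> (T A)"
    by (intro Ker_in_Cgr[OF algebra_term_alg] epimorphism_alg_hom)
  moreover have "cgr_le S (Ker S (T A) g) (Ker S (T A) ?h)"
    by (auto simp: cgr_le_def mem_Ker_iff sorted_comp_apply)
  ultimately have "Ker S (T A) ?h \<in> \<FF> A"
    using ker formation_cgr_filter[OF \<FF> A] unfolding cgr_filter_def by blast
  then show ?thesis using A h D unfolding algebras_of_def by blast
qed

text \<open>Cover \<open>D\<close> by \<open>p\<close> from the term algebra on its own elements.
  The kernel of \<open>p\<close> is the intersection of the kernels of the \<open>k \<alpha>\<close>
  after \<open>p\<close>; these lie in \<open>\<FF> (car D)\<close> because the covers of each
  \<open>C \<alpha>\<close> are interchangeable.\<close>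

lemma algebras_of_subdirect:
  fixes n :: nat
  assumes \<FF>: "formation_cgr U S \<Sigma> \<FF>" and D: "D \<in> Alg U S \<Sigma>"
    and C: "\<And>\<alpha>. \<alpha> < n \<Longrightarrow> C \<alpha> \<in> algebras_of \<FF>"
    and f: "subdirect_embedding S \<Sigma> {..<n} D C f"
  shows "D \<in> algebras_of \<FF>"
proof -
  note Dalg = Alg_algebra[OF D] and A = Alg_car[OF D]
  obtain k where k: "\<And>\<alpha>. \<alpha> < n \<Longrightarrow> epimorphism S \<Sigma> D (C \<alpha>) (k \<alpha>)"
    and inj: "\<And>s x y. s \<in> S \<Longrightarrow> x \<in> car D s \<Longrightarrow> y \<in> car D s \<Longrightarrow>
      (\<forall>\<alpha><n. k \<alpha> s x = k \<alpha> s y) \<Longrightarrow> x = y"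
    using f ex_subdirect_embedding_iff[OF Dalg, of "{..<n}" C] by (metis lessThan_iff)
  let ?T = "T (car D)"
  obtain p where p: "epimorphism S \<Sigma> ?T D p" by (rule ex_term_alg_epimorphism[OF Dalg])
  note pc = alg_hom_closed[OF epimorphism_alg_hom[OF p]]
  \<comment> \<open>The intersection of the first \<open>m\<close> kernels. The empty one,
    \<open>K 0\<close>, is the full congruence, which lies in every nonempty upward closed set of
    congruences.\<close>
  define K where "K m = (\<lambda>s\<in>S. {(x, y). x \<in> car ?T s \<and> y \<in> car ?T s \<and>
    (\<forall>\<alpha><m. k \<alpha> s (p s x) = k \<alpha> s (p s y))})" for m
  have filter: "cgr_filter S \<Sigma> ?T (\<FF> (car D))" by (rule formation_cgr_filter[OF \<FF> A])
  have "K m \<in> \<FF> (car D)" if "m \<le> n" for m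
    using that
  proof (induction m)
    case 0
    obtain \<Phi> where \<Phi>: "\<Phi> \<in> \<FF> (car D)" using filter unfolding cgr_filter_def by blast
    then have "\<Phi> \<in> Cgr S \<Sigma> ?T" using filter unfolding cgr_filter_def by blast
    then have "cgr_le S \<Phi> (\<lambda>s\<in>S. car ?T s \<times> car ?T s)"
      using Cgr_subset[of \<Phi> S \<Sigma> ?T] by (simp add: cgr_le_def)
    then have "(\<lambda>s\<in>S. car ?T s \<times> car ?T s) \<in> \<FF> (car D)"
      using filter \<Phi> full_congruence[OF algebra_term_alg] unfolding cgr_filter_def by blast
    moreover have "K 0 = (\<lambda>s\<in>S. car ?T s \<times> car ?T s)"
      unfolding K_def by (intro restrict_ext) auto
    ultimately show ?case by (simp only:)
  next
    case (Suc m)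
    let ?h = "sorted_comp S (car ?T) (k m) p"
    have m: "m < n" using Suc.prems by simp
    have "Ker S ?T ?h \<in> \<FF> (car D)"
      by (rule Ker_mem_formation_cgr[OF \<FF> A C[OF m] sorted_comp_epimorphism[OF algebra_term_alg p k[OF m]]])
    then have "cgr_inter S (K m) (Ker S ?T ?h) \<in> \<FF> (car D)"
      using Suc filter unfolding cgr_filter_def by simp
    moreover have "cgr_inter S (K m) (Ker S ?T ?h) = K (Suc m)"
      unfolding cgr_inter_def K_def
      by (intro restrict_ext) (auto simp: mem_Ker_iff sorted_comp_apply less_Suc_eq)
    ultimately show ?case by (simp only:)
  qed
  then have "K n \<in> \<FF> (car D)" by simp
  moreover have "(\<forall>\<alpha><n. k \<alpha> s (p s x) = k \<alpha> s (p s y)) \<longleftrightarrow> p s x = p s y"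
    if "s \<in> S" "x \<in> car ?T s" "y \<in> car ?T s" for s x y
    using inj[OF that(1) pc[OF that(1,2)] pc[OF that(1,3)]] by auto
  then have "K n = Ker S ?T p"
    unfolding K_def Ker_def by (intro restrict_ext) auto
  ultimately show ?thesis using A p D unfolding algebras_of_def by auto
qed

lemma algebras_of_formation_alg:
  assumes \<FF>: "formation_cgr U S \<Sigma> \<FF>"
  shows "formation_alg U S \<Sigma> (algebras_of \<FF>)"
  unfolding formation_alg_def
proof (intro conjI ballI allI impI)
  show "algebras_of \<FF> \<subseteq> Alg U S \<Sigma>" by (auto simp: algebras_of_def)
  \<comment> \<open>Any sorted set would do; its filter is nonempty, and a quotient by one of its
    congruences is the required member.\<close>
  note A = empty_in_sorted_sets
  obtain \<Theta> where \<Theta>: "\<Theta> \<in> \<FF> (\<lambda>s\<in>S. {})" "\<Theta> \<in> Cgr S \<Sigma> (T (\<lambda>s\<in>S. {}))"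
    using formation_cgr_filter[OF \<FF> A] unfolding cgr_filter_def by blast
  obtain C q where "C \<in> Alg U S \<Sigma>" "epimorphism S \<Sigma> (T (\<lambda>s\<in>S. {})) C q"
    "Ker S (T (\<lambda>s\<in>S. {})) q = \<Theta>"
    by (rule ex_Alg_quotient[OF A \<Theta>(2)])
  then have "C \<in> algebras_of \<FF>" using A \<Theta>(1) unfolding algebras_of_def by blast
  then show "algebras_of \<FF> \<noteq> {}" by blast
next
  fix A B assume "A \<in> algebras_of \<FF>" "B \<in> Alg U S \<Sigma>" "isomorphic S \<Sigma> A B"
  then show "B \<in> algebras_of \<FF>" using algebras_of_epimorphism[OF \<FF>] unfolding isomorphic_def by blast
next
  fix A B assume "B \<in> algebras_of \<FF>" "A \<in> Alg U S \<Sigma>" "\<exists>f. epimorphism S \<Sigma> B A f"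
  then show "A \<in> algebras_of \<FF>" using algebras_of_epimorphism[OF \<FF>] by blast
next
  fix A C and n :: nat
  assume "A \<in> Alg U S \<Sigma>"
    "(\<forall>\<alpha><n. C \<alpha> \<in> algebras_of \<FF>) \<and> (\<exists>f. subdirect_embedding S \<Sigma> {..<n} A C f)"
  then show "A \<in> algebras_of \<FF>" using algebras_of_subdirect[OF \<FF>] by blast
qed

text \<open>An algebra \<open>D\<close> obtained from the congruences of \<open>\<F>\<close> shares
  a kernel on some \<open>T(A)\<close> with a member \<open>C\<close> of \<open>\<F>\<close>, hence
  is an epimorphic image of \<open>C\<close>.\<close>

lemma algebras_of_congruences_of:
  assumes \<F>: "formation_alg U S \<Sigma> \<F>"
  shows "algebras_of (congruences_of \<F>) = \<F>"
proof (intro equalityI subsetI)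
  fix D assume "D \<in> algebras_of (congruences_of \<F>)"
  then obtain A h where D: "D \<in> Alg U S \<Sigma>" and A: "A \<in> sorted_sets U S"
    and h: "epimorphism S \<Sigma> (T A) D h" and "Ker S (T A) h \<in> congruences_of \<F> A"
    unfolding algebras_of_def by blast
  then obtain C g where C: "C \<in> \<F>" "epimorphism S \<Sigma> (T A) C g" "Ker S (T A) h = Ker S (T A) g"
    unfolding mem_congruences_of_iff[OF A] by blast
  have "algebra S \<Sigma> C" using C(1) formation_alg_subset[OF \<F>] Alg_algebra by blast
  then obtain k where "epimorphism S \<Sigma> C D k"
    using epimorphism_factor_epimorphism[OF _ algebra_term_alg C(2) h] Ker_eqD[OF C(3)] by metis
  then show "D \<in> \<F>" by (rule formation_alg_epimorphism[OF \<F> C(1) D])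
next
  fix C assume C: "C \<in> \<F>"
  then have C': "C \<in> Alg U S \<Sigma>" using formation_alg_subset[OF \<F>] by blast
  obtain p where p: "epimorphism S \<Sigma> (T (car C)) C p"
    by (rule ex_term_alg_epimorphism[OF Alg_algebra[OF C']])
  then have "Ker S (T (car C)) p \<in> congruences_of \<F> (car C)"
    using C unfolding mem_congruences_of_iff[OF Alg_car[OF C']] by blast
  then show "C \<in> algebras_of (congruences_of \<F>)"
    using p C' Alg_car[OF C'] unfolding algebras_of_def by blast
qed

text \<open>One inclusion is the independence of the cover; the other needs every
  \<open>\<Theta>\<close> in \<open>\<FF> A\<close> to be the kernel of an epimorphism onto an
  algebra over the universe.\<close>

lemma congruences_of_algebras_of:
  assumes \<FF>: "formation_cgr U S \<Sigma> \<FF>"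
  shows "congruences_of (algebras_of \<FF>) = \<FF>"
proof (rule extensionalityI)
  show "congruences_of (algebras_of \<FF>) \<in> extensional (sorted_sets U S)"
    by (simp add: congruences_of_def)
  show "\<FF> \<in> extensional (sorted_sets U S)" using \<FF> by (simp add: formation_cgr_def)
  fix A assume A: "A \<in> sorted_sets U S"
  show "congruences_of (algebras_of \<FF>) A = \<FF> A"
  proof (intro equalityI subsetI)
    fix \<Theta> assume "\<Theta> \<in> congruences_of (algebras_of \<FF>) A"
    then show "\<Theta> \<in> \<FF> A"
      unfolding mem_congruences_of_iff[OF A] using Ker_mem_formation_cgr[OF \<FF> A] by blast
  next
    fix \<Theta> assume \<Theta>: "\<Theta> \<in> \<FF> A"
    then have cgr: "\<Theta> \<in> Cgr S \<Sigma> (T A)"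
      using formation_cgr_filter[OF \<FF> A] unfolding cgr_filter_def by blast
    obtain C q where C: "C \<in> Alg U S \<Sigma>" "epimorphism S \<Sigma> (T A) C q" "Ker S (T A) q = \<Theta>"
      by (rule ex_Alg_quotient[OF A cgr])
    then have "C \<in> algebras_of \<FF>" using A \<Theta> unfolding algebras_of_def by blast
    then show "\<Theta> \<in> congruences_of (algebras_of \<FF>) A"
      unfolding mem_congruences_of_iff[OF A] using C by blast
  qed
qed

section \<open>Order, completeness and the isomorphism\<close>

lemma partial_order_Form_Alg: "partial_order (Form_Alg U S \<Sigma>)"
  by unfold_locales (auto simp: Form_Alg_def)

lemma partial_order_Form_Cgr: "partial_order (Form_Cgr U S \<Sigma>)"
proof unfold_locales
  fix \<FF> \<GG>
  assume *: "\<FF> \<in> carrier (Form_Cgr U S \<Sigma>)" "\<GG> \<in> carrier (Form_Cgr U S \<Sigma>)"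
    "\<FF> \<sqsubseteq>\<^bsub>Form_Cgr U S \<Sigma>\<^esub> \<GG>" "\<GG> \<sqsubseteq>\<^bsub>Form_Cgr U S \<Sigma>\<^esub> \<FF>"
  \<comment> \<open>The order compares values only on \<open>sorted_sets U S\<close>; antisymmetry
    holds because the functions are extensional there.\<close>
  then have "\<FF> = \<GG>"
    by (intro extensionalityI[of _ "sorted_sets U S"]) (auto simp: Form_Cgr_def formation_cgr_def)
  then show "\<FF> .=\<^bsub>Form_Cgr U S \<Sigma>\<^esub> \<GG>" by (simp add: Form_Cgr_def)
qed (fastforce simp: Form_Cgr_def)+

lemma complete_lattice_Form_Alg: "complete_lattice (Form_Alg U S \<Sigma>)"
proof (rule partial_order.complete_lattice_criterion1[OF partial_order_Form_Alg])
  let ?L = "Form_Alg U S \<Sigma>"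
  let ?A = "\<lambda>s\<in>S. {} :: 'v set"
  obtain C q where C: "C \<in> Alg U S \<Sigma>" "epimorphism S \<Sigma> (T ?A) C q"
    "Ker S (T ?A) q = (\<lambda>s\<in>S. car (T ?A) s \<times> car (T ?A) s)"
    by (rule ex_Alg_quotient[OF empty_in_sorted_sets full_congruence[OF algebra_term_alg]])
  have "formation_alg U S \<Sigma> (Alg U S \<Sigma>)"
    using C(1) unfolding formation_alg_def by blast
  then have "greatest ?L (Alg U S \<Sigma>) (carrier ?L)"
    by (auto simp: greatest_def Form_Alg_def formation_alg_def)
  then show "\<exists>g. greatest ?L g (carrier ?L)" by blast
  fix X assume X: "X \<subseteq> carrier ?L" "X \<noteq> {}"
  then have form: "formation_alg U S \<Sigma> \<F>" if "\<F> \<in> X" for \<F> using that by (auto simp: Form_Alg_def)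
  \<comment> \<open>The closure conditions pass to intersections, but nonemptiness does not;
    \<open>C\<close> is a member common to all formations.\<close>
  have "C \<in> \<Inter>X" using full_quotient_in_formation[OF form C] by blast
  then have "formation_alg U S \<Sigma> (\<Inter>X)"
    using X(2) form unfolding formation_alg_def by blast
  then have "greatest ?L (\<Inter>X) (Lower ?L X)"
    using X by (auto simp: greatest_def Lower_def Form_Alg_def)
  then show "\<exists>i. greatest ?L i (Lower ?L X)" by blast
qed

lemma order_isomorphism_congruences_of:
  "order_isomorphism (Form_Alg U S \<Sigma>) (Form_Cgr U S \<Sigma>) congruences_of"
  unfolding order_isomorphism_def order_emb_def
proof (intro conjI ballI)
  show "bij_betw congruences_of (carrier (Form_Alg U S \<Sigma>)) (carrier (Form_Cgr U S \<Sigma>))"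
    by (rule bij_betw_byWitness[where f' = algebras_of])
      (auto simp: Form_Alg_def Form_Cgr_def algebras_of_congruences_of congruences_of_algebras_of
        congruences_of_formation_cgr algebras_of_formation_alg)
  show "weak_partial_order (Form_Alg U S \<Sigma>)"
    by (rule partial_order.axioms(1)[OF partial_order_Form_Alg])
  show "weak_partial_order (Form_Cgr U S \<Sigma>)"
    by (rule partial_order.axioms(1)[OF partial_order_Form_Cgr])
  fix \<F> \<G> assume "\<F> \<in> carrier (Form_Alg U S \<Sigma>)" "\<G> \<in> carrier (Form_Alg U S \<Sigma>)"
  then have form: "formation_alg U S \<Sigma> \<F>" "formation_alg U S \<Sigma> \<G>" by (simp_all add: Form_Alg_def)
  \<comment> \<open>The order is reflected because the inverse assignment is monotone too.\<close>
  have "\<F> \<subseteq> \<G>" if "\<forall>A\<in>sorted_sets U S. congruences_of \<F> A \<subseteq> congruences_of \<G> A"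
  proof -
    have "algebras_of (congruences_of \<F>) \<subseteq> algebras_of (congruences_of \<G>)"
      using that unfolding algebras_of_def by blast
    then show ?thesis by (simp add: algebras_of_congruences_of form)
  qed
  moreover have "congruences_of \<F> A \<subseteq> congruences_of \<G> A"
    if "\<F> \<subseteq> \<G>" "A \<in> sorted_sets U S" for A
    unfolding subset_iff mem_congruences_of_iff[OF that(2)] using that(1) by blast
  ultimately show "congruences_of \<F> \<sqsubseteq>\<^bsub>Form_Cgr U S \<Sigma>\<^esub> congruences_of \<G> \<longleftrightarrow>
      \<F> \<sqsubseteq>\<^bsub>Form_Alg U S \<Sigma>\<^esub> \<G>"
    unfolding Form_Alg_def Form_Cgr_def by auto
qed

end

lemma complete_lattice_order_isomorphism:
  assumes L: "complete_lattice L" and M: "partial_order M" and h: "order_isomorphism L M h"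
  shows "complete_lattice M"
proof (rule partial_order.complete_latticeI[OF M])
  have bij: "bij_betw h (carrier L) (carrier M)"
    and le: "\<And>x y. x \<in> carrier L \<Longrightarrow> y \<in> carrier L \<Longrightarrow> h x \<sqsubseteq>\<^bsub>M\<^esub> h y \<longleftrightarrow> x \<sqsubseteq>\<^bsub>L\<^esub> y"
    using h unfolding order_isomorphism_def order_emb_def by blast+
  have carrier: "carrier M = h ` carrier L" using bij by (simp add: bij_betw_def)
  fix Y assume "Y \<subseteq> carrier M"
  then obtain X where X: "X \<subseteq> carrier L" "Y = h ` X" unfolding carrier by (auto simp: subset_image_iff)
  have hX: "h x \<in> carrier M" "x \<in> carrier L" if "x \<in> X" for x using X(1) that carrier by auto
  \<comment> \<open>\<open>Upper\<close> and \<open>Lower\<close> intersect their argument with the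
    carrier; these equations remove the intersection.\<close>
  have XI: "X \<inter> carrier L = X" "h ` X \<inter> carrier M = h ` X" using hX by auto
  have mem: "h u \<in> Upper M Y \<longleftrightarrow> u \<in> Upper L X" "h u \<in> Lower M Y \<longleftrightarrow> u \<in> Lower L X"
    if "u \<in> carrier L" for u
    unfolding Upper_def Lower_def X(2) XI using that carrier by (auto simp: hX le)
  have image: "\<exists>u\<in>carrier L. v = h u" if "v \<in> Upper M Y \<union> Lower M Y" for v
    using that carrier by (auto simp: Upper_def Lower_def)
  obtain s where s: "s \<in> carrier L" "s \<in> Upper L X" "\<And>u. u \<in> Upper L X \<Longrightarrow> s \<sqsubseteq>\<^bsub>L\<^esub> u"
    using complete_lattice.sup_exists[OF L X(1)] unfolding least_def by blast
  have s': "least M (h s) (Upper M Y)"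
    unfolding least_def
  proof (intro conjI ballI)
    show "h s \<in> Upper M Y" by (simp add: mem s(1,2))
    fix v assume v: "v \<in> Upper M Y"
    then obtain u where "u \<in> carrier L" "v = h u" using image by blast
    then show "h s \<sqsubseteq>\<^bsub>M\<^esub> v" using v s mem(1) le by metis
  qed (simp add: Upper_def)
  obtain i where i: "i \<in> carrier L" "i \<in> Lower L X" "\<And>u. u \<in> Lower L X \<Longrightarrow> u \<sqsubseteq>\<^bsub>L\<^esub> i"
    using complete_lattice.inf_exists[OF L X(1)] unfolding greatest_def by blast
  have i': "greatest M (h i) (Lower M Y)"
    unfolding greatest_def
  proof (intro conjI ballI)
    show "h i \<in> Lower M Y" by (simp add: mem i(1,2))
    fix v assume v: "v \<in> Lower M Y"
    then obtain u where "u \<in> carrier L" "v = h u" using image by blast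
    then show "v \<sqsubseteq>\<^bsub>M\<^esub> h i" using v i mem(2) le by metis
  qed (simp add: Lower_def)
  show "\<exists>s. least M s (Upper M Y)" "\<exists>i. greatest M i (Lower M Y)" using s' i' by blast+
qed

theorem proposition3p15:
  fixes elts :: "'v \<Rightarrow> 'v set"
    and S :: "'v set"
    and \<Sigma> :: "'v list \<Rightarrow> 'v \<Rightarrow> 'v set"
  assumes "grothendieck_universe elts"
    and "S \<in> range elts"
    and "\<And>w s. w \<in> lists S \<Longrightarrow> s \<in> S \<Longrightarrow> \<Sigma> w s \<in> range elts"
  shows "complete_lattice (Form_Alg (range elts) S \<Sigma>) \<and>
         complete_lattice (Form_Cgr (range elts) S \<Sigma>) \<and>
         (\<exists>h. order_isomorphism (Form_Alg (range elts) S \<Sigma>) (Form_Cgr (range elts) S \<Sigma>) h)"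
proof -
  interpret grothendieck_universe elts by (rule assms(1))
  interpret small_signature elts S \<Sigma>
    by unfold_locales (simp_all add: small_iff_range assms(2,3))
  show ?thesis
    using complete_lattice_Form_Alg order_isomorphism_congruences_of
      complete_lattice_order_isomorphism[OF complete_lattice_Form_Alg partial_order_Form_Cgr
        order_isomorphism_congruences_of]
    by blast
qed

end
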